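(* Let $L$ be the Fra\"iss\'e limit of the class of all finite nontrivial Heyting algebras, and let $B\supseteq L$ be the countable atomless Boolean algebra constructed from $L$ as described in the context. Every automorphism $f:L\to L$ can be extended (as a function between pure sets) to an automorphism $\hat f: B\to B$ of the Boolean algebra $B$, and this extension is unique. Moreover, $f\mapsto\hat f$ defines an injective group homomorphism $\mathrm{Aut}(L)\hookrightarrow\mathrm{Aut}(B)$ that is a homeomorphism onto its image.
   Context: Heyting algebras are structures in the language $\{0,1,\wedge,\vee,\to\}$; nontrivial means $0\neq 1$. The Fra\"iss\'e limit $L$ is the (unique up to isomorphism) countable Heyting algebra that is ultrahomogeneous (every isomorphism between finitely generated substructures of $L$ extends to an automorphism of $L$) and whose finitely generated substructures are, up to isomorphism, exactly the finite nontrivial Heyting algebras. It is known to exist. For a finite Heyting algebra $H$, its dual poset $P$ is the set of join-prime elements of $H$ with the reversed order; $H$ is isomorphic to the Heyting algebra of up-sets (upward closed subsets) of $P$ ordered by inclusion, and we identify $H$ with it. A map $f:P\to P'$ between posets is p-morphic if it is monotone and for all $u\in P$ and $v\ge f(u)$ there is $w\ge u$ with $f(w)=v$. A Heyting algebra embedding $H\hookrightarrow H_1$ of finite Heyting algebras is given by taking inverse images of up-sets under a unique surjective p-morphism $P_1\to P$ between the dual posets. Construction of $B$: write $L=\bigcup_{i<\omega}L_i$ as the union of a chain of finite Heyting subalgebras $L_i\subseteq L_{i+1}$. Let $P_i$ be the dual poset of $L_i$ and $B_i=\mathcal P(P_i)$, the power set Boolean algebra of $P_i$, so that $L_i\subseteq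 B_i$ as the set of up-sets of $P_i$. The surjective p-morphism $P_{i+1}\to P_i$ dual to $L_i\subseteq L_{i+1}$ induces, by taking inverse images, an injective Boolean algebra homomorphism $B_i\to B_{i+1}$ extending the inclusion $L_i\subseteq L_{i+1}$; regard it as an inclusion $B_i\subseteq B_{i+1}$. Put $B=\bigcup_{i<\omega}B_i$. Then $B$ is a countable atomless Boolean algebra containing $L=\bigcup_i L_i$. Automorphism groups of countable structures carry the topology of pointwise convergence, in which the pointwise stabilizers of finite sets form a neighbourhood basis of the identity. *)

theory Defs
  imports "HOL-Analysis.Function_Topology" "HOL-Algebra.Bij"
begin

section \<open>Heyting algebras as structures in the language 0, 1, meet, join, implication\<close>

record 'a lattice01 = "'a partial_object" +
  lzero :: 'a
  lone :: 'a
  lmeet :: "'a \<Rightarrow> 'a \<Rightarrow> 'a" (infixl \<open>\<curlywedge>\<index>\<close> 70)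
  ljoin :: "'a \<Rightarrow> 'a \<Rightarrow> 'a" (infixl \<open>\<curlyvee>\<index>\<close> 65)

record 'a heyting = "'a lattice01" +
  himp :: "'a \<Rightarrow> 'a \<Rightarrow> 'a" (infixr \<open>\<leadsto>\<index>\<close> 60)

definition lle :: "('a, 'b) lattice01_scheme \<Rightarrow> 'a \<Rightarrow> 'a \<Rightarrow> bool" (infix \<open>\<preceq>\<index>\<close> 50)
  where "x \<preceq>\<^bsub>H\<^esub> y \<longleftrightarrow> x \<curlywedge>\<^bsub>H\<^esub> y = x"

locale heyting_algebra =
  fixes H :: "'a heyting" (structure)
  assumes zero_closed: "lzero H \<in> carrier H"
    and one_closed: "lone H \<in> carrier H"
    and meet_closed: "\<lbrakk>x \<in> carrier H; y \<in> carrier H\<rbrakk> \<Longrightarrow> x \<curlywedge> y \<in> carrier H"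
    and join_closed: "\<lbrakk>x \<in> carrier H; y \<in> carrier H\<rbrakk> \<Longrightarrow> x \<curlyvee> y \<in> carrier H"
    and imp_closed: "\<lbrakk>x \<in> carrier H; y \<in> carrier H\<rbrakk> \<Longrightarrow> x \<leadsto> y \<in> carrier H"
    and meet_commute: "\<lbrakk>x \<in> carrier H; y \<in> carrier H\<rbrakk> \<Longrightarrow> x \<curlywedge> y = y \<curlywedge> x"
    and join_commute: "\<lbrakk>x \<in> carrier H; y \<in> carrier H\<rbrakk> \<Longrightarrow> x \<curlyvee> y = y \<curlyvee> x"
    and meet_assoc: "\<lbrakk>x \<in> carrier H; y \<in> carrier H; z \<in> carrier H\<rbrakk>
          \<Longrightarrow> (x \<curlywedge> y) \<curlywedge> z = x \<curlywedge> (y \<curlywedge> z)"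
    and join_assoc: "\<lbrakk>x \<in> carrier H; y \<in> carrier H; z \<in> carrier H\<rbrakk>
          \<Longrightarrow> (x \<curlyvee> y) \<curlyvee> z = x \<curlyvee> (y \<curlyvee> z)"
    and meet_absorb: "\<lbrakk>x \<in> carrier H; y \<in> carrier H\<rbrakk> \<Longrightarrow> x \<curlywedge> (x \<curlyvee> y) = x"
    and join_absorb: "\<lbrakk>x \<in> carrier H; y \<in> carrier H\<rbrakk> \<Longrightarrow> x \<curlyvee> (x \<curlywedge> y) = x"
    and zero_least: "x \<in> carrier H \<Longrightarrow> lzero H \<preceq> x"
    and one_greatest: "x \<in> carrier H \<Longrightarrow> x \<preceq> lone H"
    and residuation: "\<lbrakk>x \<in> carrier H; y \<in> carrier H; z \<in> carrier H\<rbrakk>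
          \<Longrightarrow> z \<preceq> x \<leadsto> y \<longleftrightarrow> z \<curlywedge> x \<preceq> y"

definition finite_nontrivial_heyting :: "'a heyting \<Rightarrow> bool"
  where "finite_nontrivial_heyting H \<longleftrightarrow>
    heyting_algebra H \<and> finite (carrier H) \<and> lzero H \<noteq> lone H"

definition heyting_iso :: "'a heyting \<Rightarrow> 'b heyting \<Rightarrow> ('a \<Rightarrow> 'b) set"
  where "heyting_iso H K = {f. bij_betw f (carrier H) (carrier K) \<and>
    f (lzero H) = lzero K \<and> f (lone H) = lone K \<and>
    (\<forall>x\<in>carrier H. \<forall>y\<in>carrier H.
        f (x \<curlywedge>\<^bsub>H\<^esub> y) = f x \<curlywedge>\<^bsub>K\<^esub> f y \<and>
        f (x \<curlyvee>\<^bsub>H\<^esub> y) = f x \<curlyvee>\<^bsub>K\<^esub> f y \<and>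
        f (x \<leadsto>\<^bsub>H\<^esub> y) = f x \<leadsto>\<^bsub>K\<^esub> f y)}"

definition subuniverse :: "'a heyting \<Rightarrow> 'a set \<Rightarrow> bool"
  where "subuniverse H S \<longleftrightarrow> S \<subseteq> carrier H \<and> lzero H \<in> S \<and> lone H \<in> S \<and>
    (\<forall>x\<in>S. \<forall>y\<in>S. x \<curlywedge>\<^bsub>H\<^esub> y \<in> S \<and> x \<curlyvee>\<^bsub>H\<^esub> y \<in> S \<and> x \<leadsto>\<^bsub>H\<^esub> y \<in> S)"

abbreviation substructure :: "'a heyting \<Rightarrow> 'a set \<Rightarrow> 'a heyting"
  where "substructure H S \<equiv> H\<lparr>carrier := S\<rparr>"

definition finitely_generated :: "'a heyting \<Rightarrow> 'a set \<Rightarrow> bool"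
  where "finitely_generated H S \<longleftrightarrow>
    (\<exists>X. finite X \<and> X \<subseteq> carrier H \<and> S = \<Inter>{T. subuniverse H T \<and> X \<subseteq> T})"


section \<open>The Fraisse limit\<close>

definition ultrahomogeneous :: "'a heyting \<Rightarrow> bool"
  where "ultrahomogeneous H \<longleftrightarrow>
    (\<forall>S T f. finitely_generated H S \<and> finitely_generated H T \<and>
        f \<in> heyting_iso (substructure H S) (substructure H T)
      \<longrightarrow> (\<exists>g \<in> heyting_iso H H. \<forall>x\<in>S. g x = f x))"

text \<open>
  Every finite structure is isomorphic to one whose carrier is a set of natural numbers, so
  quantifying over structures on \<^typ>\<open>nat\<close> in the last clause covers all finite nontrivial
  Heyting algebras up to isomorphism.
\<close>
definition heyting_fraisse_limit :: "'a heyting \<Rightarrow> bool"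
  where "heyting_fraisse_limit L \<longleftrightarrow>
    heyting_algebra L \<and> countable (carrier L) \<and> ultrahomogeneous L \<and>
    (\<forall>S. finitely_generated L S \<longrightarrow> finite_nontrivial_heyting (substructure L S)) \<and>
    (\<forall>H :: nat heyting. finite_nontrivial_heyting H \<longrightarrow>
      (\<exists>S. finitely_generated L S \<and> heyting_iso H (substructure L S) \<noteq> {}))"


section \<open>Duality for finite Heyting algebras\<close>

definition join_prime :: "'a heyting \<Rightarrow> 'a \<Rightarrow> bool"
  where "join_prime H p \<longleftrightarrow> p \<in> carrier H \<and> p \<noteq> lzero H \<and>
    (\<forall>x\<in>carrier H. \<forall>y\<in>carrier H. p \<preceq>\<^bsub>H\<^esub> x \<curlyvee>\<^bsub>H\<^esub> y \<longrightarrow> p \<preceq>\<^bsub>H\<^esub> x \<or> p \<preceq>\<^bsub>H\<^esub> y)"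

definition dual_poset :: "'a heyting \<Rightarrow> 'a gorder"
  where "dual_poset H =
    \<lparr>carrier = {p. join_prime H p}, eq = (=), le = (\<lambda>p q. q \<preceq>\<^bsub>H\<^esub> p)\<rparr>"

text \<open>The canonical isomorphism from a finite \<open>H\<close> onto the up-sets of its dual poset.\<close>
definition upset_of :: "'a heyting \<Rightarrow> 'a \<Rightarrow> 'a set"
  where "upset_of H x = {p \<in> carrier (dual_poset H). p \<preceq>\<^bsub>H\<^esub> x}"

definition p_morphism :: "'a gorder \<Rightarrow> 'b gorder \<Rightarrow> ('a \<Rightarrow> 'b) \<Rightarrow> bool"
  where "p_morphism P P' f \<longleftrightarrow>
    f \<in> carrier P \<rightarrow> carrier P' \<and> isotone P P' f \<and>
    (\<forall>u\<in>carrier P. \<forall>v\<in>carrier P'. f u \<sqsubseteq>\<^bsub>P'\<^esub> v \<longrightarrow> (\<exists>w\<in>carrier P. u \<sqsubseteq>\<^bsub>P\<^esub> w \<and> f w = v))"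

text \<open>
  For a subalgebra \<open>H\<close> of a finite Heyting algebra \<open>H\<^sub>1\<close>, the unique surjective p-morphism
  \<open>P\<^sub>1 \<rightarrow> P\<close> between the dual posets whose inverse image map is the inclusion of \<open>H\<close> in \<open>H\<^sub>1\<close>.
  It is made extensional so that it is unique as a HOL function.
\<close>
definition dual_map :: "'a heyting \<Rightarrow> 'a heyting \<Rightarrow> 'a \<Rightarrow> 'a"
  where "dual_map H H\<^sub>1 = (THE f.
    f \<in> extensional (carrier (dual_poset H\<^sub>1)) \<and>
    p_morphism (dual_poset H\<^sub>1) (dual_poset H) f \<and>
    f ` carrier (dual_poset H\<^sub>1) = carrier (dual_poset H) \<and>
    (\<forall>x\<in>carrier H. upset_of H\<^sub>1 x = {q \<in> carrier (dual_poset H\<^sub>1). f q \<in> upset_of H x}))"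


section \<open>The Boolean algebra constructed from a chain of finite subalgebras\<close>

record 'a boolean = "'a lattice01" +
  bcompl :: "'a \<Rightarrow> 'a"

definition boolean_iso :: "'a boolean \<Rightarrow> 'b boolean \<Rightarrow> ('a \<Rightarrow> 'b) set"
  where "boolean_iso B C = {f. bij_betw f (carrier B) (carrier C) \<and>
    f (lzero B) = lzero C \<and> f (lone B) = lone C \<and>
    (\<forall>x\<in>carrier B. f (bcompl B x) = bcompl C (f x)) \<and>
    (\<forall>x\<in>carrier B. \<forall>y\<in>carrier B.
        f (x \<curlywedge>\<^bsub>B\<^esub> y) = f x \<curlywedge>\<^bsub>C\<^esub> f y \<and>
        f (x \<curlyvee>\<^bsub>B\<^esub> y) = f x \<curlyvee>\<^bsub>C\<^esub> f y)}"

definition finite_subalgebra_chain :: "'a heyting \<Rightarrow> (nat \<Rightarrow> 'a set) \<Rightarrow> bool"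
  where "finite_subalgebra_chain L Ls \<longleftrightarrow>
    (\<forall>i. subuniverse L (Ls i) \<and> finite (Ls i) \<and> Ls i \<subseteq> Ls (Suc i)) \<and>
    (\<Union>i. Ls i) = carrier L"

context
  fixes L :: "'a heyting" and Ls :: "nat \<Rightarrow> 'a set"
begin

definition stage_points :: "nat \<Rightarrow> 'a set"
  where "stage_points i = carrier (dual_poset (substructure L (Ls i)))"

text \<open>
  \<open>stage_incl i n\<close> is the embedding of \<open>B\<^sub>i\<close> into \<open>B\<^bsub>i+n\<^esub>\<close>, where \<open>B\<^sub>i\<close> is the power set of
  \<open>stage_points i\<close>.
\<close>
primrec stage_incl :: "nat \<Rightarrow> nat \<Rightarrow> 'a set \<Rightarrow> 'a set"
  where
    "stage_incl i 0 A = A"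
  | "stage_incl i (Suc n) A =
      {q \<in> stage_points (Suc (i + n)).
        dual_map (substructure L (Ls (i + n))) (substructure L (Ls (Suc (i + n)))) q
          \<in> stage_incl i n A}"

text \<open>
  The union of the \<open>B\<^sub>i\<close> along these embeddings is realised as the usual direct limit: a pair
  \<open>(i, A)\<close> stands for the element \<open>A\<close> of \<open>B\<^sub>i\<close>, and two pairs are identified when they agree in
  some common later stage.
\<close>
definition limit_rel :: "((nat \<times> 'a set) \<times> (nat \<times> 'a set)) set"
  where "limit_rel = {((i, A), (j, A')).
    A \<subseteq> stage_points i \<and> A' \<subseteq> stage_points j \<and>
    (\<exists>k. i \<le> k \<and> j \<le> k \<and> stage_incl i (k - i) A = stage_incl j (k - j) A')}"

definition limit_class :: "nat \<Rightarrow> 'a set \<Rightarrow> (nat \<times> 'a set) set"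
  where "limit_class i A = limit_rel `` {(i, A)}"

definition limit_op ::
    "('a set \<Rightarrow> 'a set \<Rightarrow> 'a set) \<Rightarrow> (nat \<times> 'a set) set \<Rightarrow> (nat \<times> 'a set) set \<Rightarrow> (nat \<times> 'a set) set"
  where "limit_op F X Y = (\<Union>(i, A)\<in>X. \<Union>(j, A')\<in>Y.
    limit_class (max i j)
      (F (stage_incl i (max i j - i) A) (stage_incl j (max i j - j) A')))"

definition limit_boolean :: "(nat \<times> 'a set) set boolean"
  where "limit_boolean =
    \<lparr>carrier = (SIGMA i:UNIV. Pow (stage_points i)) // limit_rel,
     lzero = limit_class 0 {},
     lone = limit_class 0 (stage_points 0),
     lmeet = limit_op (\<inter>),
     ljoin = limit_op (\<union>),
     bcompl = (\<lambda>X. \<Union>(i, A)\<in>X. limit_class i (stage_points i - A))\<rparr>"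

text \<open>
  The inclusion of \<open>L\<close> in the limit. Any \<open>i\<close> with \<open>x \<in> Ls i\<close> gives the same class.
\<close>
definition limit_embed :: "'a \<Rightarrow> (nat \<times> 'a set) set"
  where "limit_embed x =
    (let i = (LEAST i. x \<in> Ls i) in limit_class i (upset_of (substructure L (Ls i)) x))"

end


section \<open>Automorphism groups and the topology of pointwise convergence\<close>

text \<open>
  As for the library's \<open>Bij\<close>, automorphisms are taken to be extensional, so that each
  automorphism of a structure is represented by exactly one HOL function.
\<close>
definition heyting_aut :: "'a heyting \<Rightarrow> ('a \<Rightarrow> 'a) set"
  where "heyting_aut H = heyting_iso H H \<inter> Bij (carrier H)"

definition boolean_aut :: "'a boolean \<Rightarrow> ('a \<Rightarrow> 'a) set"
  where "boolean_aut B = boolean_iso B B \<inter> Bij (carrier B)"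

definition heyting_aut_group :: "'a heyting \<Rightarrow> ('a \<Rightarrow> 'a) monoid"
  where "heyting_aut_group H = BijGroup (carrier H)\<lparr>carrier := heyting_aut H\<rparr>"

definition boolean_aut_group :: "'a boolean \<Rightarrow> ('a \<Rightarrow> 'a) monoid"
  where "boolean_aut_group B = BijGroup (carrier B)\<lparr>carrier := boolean_aut B\<rparr>"

definition pointwise_topology :: "'a set \<Rightarrow> ('a \<Rightarrow> 'a) set \<Rightarrow> ('a \<Rightarrow> 'a) topology"
  where "pointwise_topology S G =
    subtopology (product_topology (\<lambda>_. discrete_topology S) S) G"

definition heyting_aut_topology :: "'a heyting \<Rightarrow> ('a \<Rightarrow> 'a) topology"
  where "heyting_aut_topology H = pointwise_topology (carrier H) (heyting_aut H)"

definition boolean_aut_topology :: "'a boolean \<Rightarrow> ('a \<Rightarrow> 'a) topology"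
  where "boolean_aut_topology B = pointwise_topology (carrier B) (boolean_aut B)"

definition is_boolean_extension ::
    "'a heyting \<Rightarrow> (nat \<Rightarrow> 'a set) \<Rightarrow> ('a \<Rightarrow> 'a)
      \<Rightarrow> ((nat \<times> 'a set) set \<Rightarrow> (nat \<times> 'a set) set) \<Rightarrow> bool"
  where "is_boolean_extension L Ls f g \<longleftrightarrow>
    g \<in> boolean_aut (limit_boolean L Ls) \<and>
    (\<forall>x\<in>carrier L. g (limit_embed L Ls x) = limit_embed L Ls (f x))"

definition boolean_extension ::
    "'a heyting \<Rightarrow> (nat \<Rightarrow> 'a set) \<Rightarrow> ('a \<Rightarrow> 'a)
      \<Rightarrow> ((nat \<times> 'a set) set \<Rightarrow> (nat \<times> 'a set) set)"
  where "boolean_extension L Ls f = (THE g. is_boolean_extension L Ls f g)"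

end

theory Submission
  imports Defs
begin

text \<open>
  A prime filter of \<open>L\<close> meets each \<open>Ls i\<close> in a principal filter generated by a point of the dual
  poset, its trace, and the dual maps send traces to traces. Every point is a trace, so a subset
  of stage \<open>i\<close> may be identified with the set of prime filters whose trace lies in it. This
  represents the limit Boolean algebra as the field of those sets of prime filters that depend
  only on the intersection with some \<open>Ls j\<close>. An automorphism of \<open>L\<close> permutes the prime filters
  and hence this field. The extension is unique because \<open>L\<close> generates the field, and its value at
  an element of stage \<open>i\<close> depends only on the restriction of the automorphism to the finite set
  \<open>Ls i\<close>, which gives continuity.
\<close>

section \<open>Order and duality in Heyting algebras\<close>

text \<open>The obstacle is that an automorphism of \<open>L\<close> need not map a stage
  \<open>Ls i\<close> into itself, so it gives no evident map on representatives
  \<open>(i, A)\<close>. Prime filters do not mention the chain, and since every finite subset of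
  \<open>L\<close> lies in some stage, depending on some \<open>Ls j\<close> means depending on
  finitely many elements of \<open>L\<close>, a condition that automorphisms preserve. Generation by
  \<open>L\<close> is settled inside one finite stage: for a join-prime \<open>p\<close> there is a
  largest \<open>m\<close> not above \<open>p\<close>, and \<open>p\<close> is the only point in the
  up-set of \<open>p\<close> that is outside the up-set of \<open>m\<close>. Implication enters in
  two places: it gives distributivity, hence enough join-primes, and it lets points be lifted to
  larger stages, which is the back condition of the dual map and the reason why every point is a
  trace. Continuity of the inverse needs a single coordinate: \<open>f x\<close> is read off from
  the value of the extension at the embedded element \<open>x\<close>.\<close>

context heyting_algebra
begin

text \<open>Idempotence of meet comes from the absorption laws: \<open>join_absorb\<close> rewrites
  the inner join in \<open>meet_absorb\<close> at \<open>x\<close> and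
  \<open>x \<curlywedge> x\<close>.\<close>

lemma le_refl: "x \<in> carrier H \<Longrightarrow> x \<preceq> x"
  unfolding lle_def
  using join_absorb[of x x] meet_absorb[of x "x \<curlywedge> x"] by (simp add: meet_closed)

lemma le_antisym: "\<lbrakk>x \<preceq> y; y \<preceq> x; x \<in> carrier H; y \<in> carrier H\<rbrakk> \<Longrightarrow> x = y"
  unfolding lle_def using meet_commute[of x y] by simp

lemma le_trans: "\<lbrakk>x \<preceq> y; y \<preceq> z; x \<in> carrier H; y \<in> carrier H; z \<in> carrier H\<rbrakk> \<Longrightarrow> x \<preceq> z"
  unfolding lle_def using meet_assoc[of x y z] by simp

lemma meet_le1: "\<lbrakk>x \<in> carrier H; y \<in> carrier H\<rbrakk> \<Longrightarrow> x \<curlywedge> y \<preceq> x"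
  unfolding lle_def
  using meet_commute[of "x \<curlywedge> y" x] meet_assoc[of x x y] le_refl[unfolded lle_def, of x]
  by (simp add: meet_closed)

lemma meet_le2: "\<lbrakk>x \<in> carrier H; y \<in> carrier H\<rbrakk> \<Longrightarrow> x \<curlywedge> y \<preceq> y"
  using meet_le1[of y x] by (simp add: meet_commute)

lemma le_meet_iff:
  "\<lbrakk>x \<in> carrier H; y \<in> carrier H; z \<in> carrier H\<rbrakk> \<Longrightarrow> z \<preceq> x \<curlywedge> y \<longleftrightarrow> z \<preceq> x \<and> z \<preceq> y"
  using meet_assoc[of z x y] le_trans[of z "x \<curlywedge> y" x] le_trans[of z "x \<curlywedge> y" y] meet_le1[of x y] meet_le2[of x y]
  by (auto simp: meet_closed) (simp add: lle_def)

lemma le_join1: "\<lbrakk>x \<in> carrier H; y \<in> carrier H\<rbrakk> \<Longrightarrow> x \<preceq> x \<curlyvee> y"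
  by (simp add: lle_def meet_absorb)

lemma le_join2: "\<lbrakk>x \<in> carrier H; y \<in> carrier H\<rbrakk> \<Longrightarrow> y \<preceq> x \<curlyvee> y"
  using le_join1[of y x] by (simp add: join_commute)

lemma le_iff_join: "\<lbrakk>x \<in> carrier H; y \<in> carrier H\<rbrakk> \<Longrightarrow> x \<preceq> y \<longleftrightarrow> x \<curlyvee> y = y"
  unfolding lle_def
  using join_absorb[of y x] meet_absorb[of x y] join_commute[of x y] meet_commute[of x y] by auto

lemma join_le_iff:
  "\<lbrakk>x \<in> carrier H; y \<in> carrier H; z \<in> carrier H\<rbrakk> \<Longrightarrow> x \<curlyvee> y \<preceq> z \<longleftrightarrow> x \<preceq> z \<and> y \<preceq> z"
  using join_assoc[of x y z] le_trans[of x "x \<curlyvee> y" z] le_trans[of y "x \<curlyvee> y" z] le_join1[of x y] le_join2[of x y]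
  by (auto simp: join_closed) (simp add: le_iff_join join_closed)

text \<open>Meeting with \<open>z\<close> is left adjoint to \<open>z \<leadsto> _\<close>, so it
  preserves joins. The opposite inequality holds in every lattice.\<close>

lemma meet_join_distrib_le:
  assumes [simp]: "x \<in> carrier H" "y \<in> carrier H" "z \<in> carrier H"
  shows "z \<curlywedge> (x \<curlyvee> y) \<preceq> (z \<curlywedge> x) \<curlyvee> (z \<curlywedge> y)"
proof -
  let ?w = "(z \<curlywedge> x) \<curlyvee> (z \<curlywedge> y)"
  have "x \<preceq> z \<leadsto> ?w" "y \<preceq> z \<leadsto> ?w"
    by (simp_all add: residuation join_closed meet_closed meet_commute[of _ z] le_join1 le_join2)
  then have "x \<curlyvee> y \<preceq> z \<leadsto> ?w"
    by (simp add: join_le_iff imp_closed join_closed meet_closed)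
  then show ?thesis
    by (simp add: residuation join_closed meet_closed meet_commute[of z])
qed

section \<open>Extremal elements, join-primes and the dual poset\<close>

lemma finite_meet_closed_has_least:
  assumes "finite S" "S \<subseteq> carrier H" "S \<noteq> {}" "\<And>x y. x \<in> S \<Longrightarrow> y \<in> S \<Longrightarrow> x \<curlywedge> y \<in> S"
  shows "\<exists>m\<in>S. \<forall>x\<in>S. m \<preceq> x"
proof -
  \<comment> \<open>The induction runs over subsets \<open>T\<close> while the bound stays in
    \<open>S\<close>, so the empty \<open>T\<close> is served by any element of
    \<open>S\<close>.\<close>
  have "\<exists>m\<in>S. \<forall>x\<in>T. m \<preceq> x" if "finite T" "T \<subseteq> S" for T
    using that
  proof (induction T)
    case empty
    then show ?case using assms(3) by auto
  next
    case (insert a T)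
    then obtain m where m: "m \<in> S" "\<forall>x\<in>T. m \<preceq> x" by auto
    then have [simp]: "m \<in> carrier H" "a \<in> carrier H" using assms(2) insert.prems by auto
    have "m \<curlywedge> a \<preceq> x" if "x \<in> insert a T" for x
      using that m(2) insert.prems assms(2) meet_le2[of m a]
        le_trans[OF meet_le1, of m a x] by (auto simp: meet_closed)
    moreover have "m \<curlywedge> a \<in> S" using m insert.prems assms(4) by auto
    ultimately show ?case by blast
  qed
  then show ?thesis using assms(1) by blast
qed

lemma finite_join_closed_has_greatest:
  assumes "finite S" "S \<subseteq> carrier H" "S \<noteq> {}" "\<And>x y. x \<in> S \<Longrightarrow> y \<in> S \<Longrightarrow> x \<curlyvee> y \<in> S"
  shows "\<exists>m\<in>S. \<forall>x\<in>S. x \<preceq> m"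
proof -
  have "\<exists>m\<in>S. \<forall>x\<in>T. x \<preceq> m" if "finite T" "T \<subseteq> S" for T
    using that
  proof (induction T)
    case empty
    then show ?case using assms(3) by auto
  next
    case (insert a T)
    then obtain m where m: "m \<in> S" "\<forall>x\<in>T. x \<preceq> m" by auto
    then have [simp]: "m \<in> carrier H" "a \<in> carrier H" using assms(2) insert.prems by auto
    have "x \<preceq> m \<curlyvee> a" if "x \<in> insert a T" for x
      using that m(2) insert.prems assms(2) le_join2[of m a]
        le_trans[OF _ le_join1, of x m a] by (auto simp: join_closed)
    moreover have "m \<curlyvee> a \<in> S" using m insert.prems assms(4) by auto
    ultimately show ?case by blast
  qed
  then show ?thesis using assms(1) by blast
qed

lemma finite_minimal:
  assumes "finite S" "S \<subseteq> carrier H" "S \<noteq> {}"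
  shows "\<exists>m\<in>S. \<forall>x\<in>S. x \<preceq> m \<longrightarrow> x = m"
proof -
  have "asymp_on S (\<lambda>x y. x \<preceq> y \<and> x \<noteq> y)"
    using assms(2) le_antisym by (blast intro: asymp_onI)
  moreover have "transp_on S (\<lambda>x y. x \<preceq> y \<and> x \<noteq> y)"
  proof (rule transp_onI)
    fix x y z
    assume "x \<in> S" "y \<in> S" "z \<in> S" "x \<preceq> y \<and> x \<noteq> y" "y \<preceq> z \<and> y \<noteq> z"
    then show "x \<preceq> z \<and> x \<noteq> z" using assms(2) le_trans[of x y z] le_antisym[of x y] by blast
  qed
  ultimately show ?thesis
    using Finite_Set.bex_min_element[OF assms(1) _ _ assms(3)] by blast
qed

text \<open>An element minimal among those below \<open>a\<close> but not below \<open>b\<close> is join-prime.\<close>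
lemma join_prime_separation:
  assumes "finite (carrier H)" "a \<in> carrier H" "b \<in> carrier H" "\<not> a \<preceq> b"
  shows "\<exists>q. join_prime H q \<and> q \<preceq> a \<and> \<not> q \<preceq> b"
proof -
  let ?S = "{z \<in> carrier H. z \<preceq> a \<and> \<not> z \<preceq> b}"
  have "a \<in> ?S" using assms le_refl by auto
  then obtain q where q: "q \<in> ?S" "\<And>x. x \<in> ?S \<Longrightarrow> x \<preceq> q \<Longrightarrow> x = q"
    using finite_minimal[of ?S] assms(1) by auto
  have [simp]: "q \<in> carrier H" "b \<in> carrier H" "a \<in> carrier H" using q assms by auto
  have "join_prime H q"
    unfolding join_prime_def
  proof (intro conjI ballI impI)
    show "q \<noteq> lzero H" using q zero_least assms(3) by auto
    fix x y
    assume [simp]: "x \<in> carrier H" "y \<in> carrier H" and le: "q \<preceq> x \<curlyvee> y"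
    show "q \<preceq> x \<or> q \<preceq> y"
    proof (rule ccontr)
      assume "\<not> (q \<preceq> x \<or> q \<preceq> y)"
      \<comment> \<open>Both meets are strictly below \<open>q\<close>, so minimality puts them
        below \<open>b\<close>. Their join is then below \<open>b\<close> too, and by distributivity
        it lies above \<open>q\<close>.\<close>
      then have "q \<curlywedge> x \<noteq> q" "q \<curlywedge> y \<noteq> q" by (auto simp: lle_def)
      then have "q \<curlywedge> x \<notin> ?S" "q \<curlywedge> y \<notin> ?S"
        using q(2)[OF _ meet_le1, of x] q(2)[OF _ meet_le1, of y] by auto
      moreover have "q \<curlywedge> x \<preceq> a" "q \<curlywedge> y \<preceq> a"
        using q(1) le_trans[OF meet_le1, of q _ a] by (auto simp: meet_closed)
      ultimately have "q \<curlywedge> x \<preceq> b" "q \<curlywedge> y \<preceq> b" by (auto simp: meet_closed)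
      then have "(q \<curlywedge> x) \<curlyvee> (q \<curlywedge> y) \<preceq> b" by (simp add: join_le_iff meet_closed)
      moreover have "q \<curlywedge> (x \<curlyvee> y) = q" using le by (simp add: lle_def)
      ultimately have "q \<preceq> b"
        using meet_join_distrib_le[of x y q] le_trans[of q "(q \<curlywedge> x) \<curlyvee> (q \<curlywedge> y)" b]
        by (simp add: meet_closed join_closed)
      then show False using q by auto
    qed
  qed simp
  then show ?thesis using q by auto
qed

text \<open>Join-primeness of \<open>p\<close> says that the elements not above \<open>p\<close> are
  closed under joins, so in the finite case they form a principal ideal. Its generator
  \<open>m\<close> serves both to lift points and to isolate them.\<close>

lemma join_prime_cut:
  assumes "finite (carrier H)" "join_prime H p"
  shows "\<exists>m\<in>carrier H. \<forall>x\<in>carrier H. x \<preceq> m \<longleftrightarrow> \<not> p \<preceq> x"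
proof -
  let ?S = "{x \<in> carrier H. \<not> p \<preceq> x}"
  have p: "p \<in> carrier H" "p \<noteq> lzero H" using assms by (auto simp: join_prime_def)
  have "\<not> p \<preceq> lzero H" using p le_antisym zero_least zero_closed by blast
  then have "lzero H \<in> ?S" using zero_closed by auto
  moreover have "\<And>x y. x \<in> ?S \<Longrightarrow> y \<in> ?S \<Longrightarrow> x \<curlyvee> y \<in> ?S"
    using assms(2) by (auto simp: join_prime_def join_closed)
  ultimately obtain m where m: "m \<in> ?S" "\<forall>x\<in>?S. x \<preceq> m"
    using finite_join_closed_has_greatest[of ?S] assms(1) by auto
  have "x \<preceq> m \<longleftrightarrow> \<not> p \<preceq> x" if "x \<in> carrier H" for x
    using m le_trans[of p x m] that p by auto
  then show ?thesis using m by auto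
qed

text \<open>\<open>isotone\<close>, and with it \<open>p_morphism\<close>, demands that both sides
  be weak partial orders.\<close>

lemma weak_partial_order_dual_poset: "weak_partial_order (dual_poset H)"
proof
  fix x y z
  assume "x \<in> carrier (dual_poset H)" "y \<in> carrier (dual_poset H)" "z \<in> carrier (dual_poset H)"
  then have [simp]: "x \<in> carrier H" "y \<in> carrier H" "z \<in> carrier H"
    by (simp_all add: dual_poset_def join_prime_def)
  show "x \<sqsubseteq>\<^bsub>dual_poset H\<^esub> y \<Longrightarrow> y \<sqsubseteq>\<^bsub>dual_poset H\<^esub> z \<Longrightarrow> x \<sqsubseteq>\<^bsub>dual_poset H\<^esub> z"
    using le_trans[of z y x] by (simp add: dual_poset_def)
qed (auto simp: dual_poset_def join_prime_def le_refl le_antisym)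

lemma heyting_algebra_substructure:
  assumes "subuniverse H S"
  shows "heyting_algebra (substructure H S)"
proof -
  have sub: "\<And>x. x \<in> S \<Longrightarrow> x \<in> carrier H" using assms by (auto simp: subuniverse_def)
  show ?thesis
    using assms
    by unfold_locales
      (auto simp: subuniverse_def lle_def meet_absorb join_absorb sub
        zero_least[unfolded lle_def] one_greatest[unfolded lle_def] residuation[unfolded lle_def]
        intro: meet_commute join_commute meet_assoc join_assoc)
qed

end

lemma lle_substructure [simp]: "x \<preceq>\<^bsub>substructure H S\<^esub> y \<longleftrightarrow> x \<preceq>\<^bsub>H\<^esub> y"
  by (simp add: lle_def)

lemma carrier_dual_poset [simp]: "carrier (dual_poset H) = {p. join_prime H p}"
  by (simp add: dual_poset_def)

lemma upset_of_iff [simp]: "p \<in> upset_of H x \<longleftrightarrow> join_prime H p \<and> p \<preceq>\<^bsub>H\<^esub> x"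
  by (simp add: upset_of_def)

lemma join_prime_closed: "join_prime H p \<Longrightarrow> p \<in> carrier H"
  by (simp add: join_prime_def)

section \<open>Points of a finite extension and the dual p-morphism\<close>

locale finite_heyting_extension = heyting_algebra H for H :: "'a heyting" (structure) +
  fixes S
  assumes finite_carrier: "finite (carrier H)" and subuniverse: "subuniverse H S"
begin

interpretation sub: heyting_algebra "substructure H S"
  using subuniverse by (rule heyting_algebra_substructure)

lemma sub_closed: "x \<in> S \<Longrightarrow> x \<in> carrier H"
  using subuniverse by (auto simp: subuniverse_def)

lemma finite_sub: "finite S"
  using finite_carrier sub_closed by (meson finite_subset subsetI)

lemma sub_join_prime_closed: "join_prime (substructure H S) p \<Longrightarrow> p \<in> S"
  by (simp add: join_prime_def)

text \<open>The least element \<open>p\<close> of \<open>S\<close> above \<open>q\<close> is the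
  value of the dual map at \<open>q\<close>. It inherits primeness because elements of
  \<open>S\<close> cannot tell \<open>p\<close> and \<open>q\<close> apart from below.\<close>

lemma least_above:
  assumes "join_prime H q"
  shows "\<exists>p. join_prime (substructure H S) p \<and> (\<forall>x\<in>S. q \<preceq> x \<longleftrightarrow> p \<preceq> x)"
proof -
  have q: "q \<in> carrier H" "q \<noteq> lzero H" using assms by (auto simp: join_prime_def)
  let ?U = "{x \<in> S. q \<preceq> x}"
  have "lone H \<in> ?U" using subuniverse one_greatest q by (auto simp: subuniverse_def)
  moreover have "\<And>x y. x \<in> ?U \<Longrightarrow> y \<in> ?U \<Longrightarrow> x \<curlywedge> y \<in> ?U"
    using subuniverse q by (auto simp: subuniverse_def le_meet_iff sub_closed)
  moreover have "finite ?U" "?U \<subseteq> carrier H" using finite_sub sub_closed by auto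
  ultimately obtain p where p: "p \<in> ?U" "\<forall>x\<in>?U. p \<preceq> x"
    using finite_meet_closed_has_least[of ?U] by auto
  then have iff: "\<forall>x\<in>S. q \<preceq> x \<longleftrightarrow> p \<preceq> x"
    using q le_trans[of q p] sub_closed by auto
  have "p \<noteq> lzero H" using p q le_antisym zero_least zero_closed by blast
  moreover have "p \<preceq> x \<or> p \<preceq> y" if "x \<in> S" "y \<in> S" "p \<preceq> x \<curlyvee> y" for x y
  proof -
    have "x \<curlyvee> y \<in> S" using that subuniverse by (simp add: subuniverse_def)
    then have "q \<preceq> x \<curlyvee> y" using that iff by simp
    then have "q \<preceq> x \<or> q \<preceq> y" using assms that sub_closed by (simp add: join_prime_def)
    then show ?thesis using iff that by simp
  qed
  ultimately have "join_prime (substructure H S) p"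
    using p by (auto simp: join_prime_def)
  then show ?thesis using iff by blast
qed

text \<open>With \<open>m\<close> the largest element of \<open>S\<close> not above \<open>v\<close>, every join-prime below \<open>z \<curlywedge> v\<close>
  but not below \<open>m\<close> lies over \<open>v\<close>. If there were none, then \<open>z \<preceq> v \<leadsto> m\<close>.\<close>
lemma join_prime_lift:
  assumes v: "join_prime (substructure H S) v" and z: "z \<in> carrier H"
    and zv: "\<And>x. x \<in> S \<Longrightarrow> z \<preceq> x \<Longrightarrow> v \<preceq> x"
  shows "\<exists>w. join_prime H w \<and> w \<preceq> z \<and> (\<forall>x\<in>S. w \<preceq> x \<longleftrightarrow> v \<preceq> x)"
proof -
  have vS: "v \<in> S" using v by (rule sub_join_prime_closed)
  obtain m where m: "m \<in> S" "\<And>x. x \<in> S \<Longrightarrow> x \<preceq> m \<longleftrightarrow> \<not> v \<preceq> x"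
    using sub.join_prime_cut[OF _ v] finite_sub by auto
  have [simp]: "v \<in> carrier H" "m \<in> carrier H" "z \<in> carrier H" using vS m z sub_closed by auto
  have nvm: "\<not> v \<preceq> m" using m(1) m(2)[of m] le_refl[of m] by simp
  have "\<not> z \<curlywedge> v \<preceq> m"
  proof
    assume "z \<curlywedge> v \<preceq> m"
    then have "z \<preceq> v \<leadsto> m" by (simp add: residuation)
    moreover have "v \<leadsto> m \<in> S" using vS m subuniverse by (auto simp: subuniverse_def)
    ultimately have "v \<preceq> v \<leadsto> m" using zv by auto
    then have "v \<curlywedge> v \<preceq> m" by (simp add: residuation)
    then show False using nvm le_refl[of v] by (simp add: lle_def)
  qed
  then obtain w where w: "join_prime H w" "w \<preceq> z \<curlywedge> v" "\<not> w \<preceq> m"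
    using join_prime_separation[of "z \<curlywedge> v" m] finite_carrier by (auto simp: meet_closed)
  have [simp]: "w \<in> carrier H" using w by (simp add: join_prime_def)
  have wz: "w \<preceq> z" "w \<preceq> v" using w by (simp_all add: le_meet_iff)
  have "w \<preceq> x \<longleftrightarrow> v \<preceq> x" if "x \<in> S" for x
    using that wz w m(2)[OF that] le_trans[of w v x] le_trans[of w x m] sub_closed by auto
  then show ?thesis using w wz by blast
qed

text \<open>Above the top element there is only the top itself, so the lifting lemma applies at
  \<open>lone H\<close> to every \<open>v\<close>. This gives surjectivity of the dual map.\<close>

lemma join_prime_lift_one:
  assumes "join_prime (substructure H S) v"
  shows "\<exists>w. join_prime H w \<and> (\<forall>x\<in>S. w \<preceq> x \<longleftrightarrow> v \<preceq> x)"
proof -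
  have "v \<preceq> x" if "x \<in> S" "lone H \<preceq> x" for x
    using that sub_closed sub_join_prime_closed[OF assms] one_greatest one_closed le_trans by blast
  then show ?thesis using join_prime_lift[OF assms, of "lone H"] one_closed by blast
qed

lemma sub_join_prime_unique:
  assumes "p \<in> S" "p' \<in> S" "\<And>x. x \<in> S \<Longrightarrow> p \<preceq> x \<longleftrightarrow> p' \<preceq> x"
  shows "p = p'"
  using assms le_refl le_antisym sub_closed by blast

text \<open>\<open>dual_map\<close> is a definite description, so nothing is known of it before
  existence and uniqueness are shown. The witness sends \<open>q\<close> to the least element of
  \<open>S\<close> above it; later arguments rely on these two properties alone.\<close>

lemma dual_map_spec:
  assumes "join_prime H q"
  shows "join_prime (substructure H S) (dual_map (substructure H S) H q)"
    and "x \<in> S \<Longrightarrow> dual_map (substructure H S) H q \<preceq> x \<longleftrightarrow> q \<preceq> x"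
proof -
  let ?K = "substructure H S"
  define dual where "dual f \<longleftrightarrow> f \<in> extensional (carrier (dual_poset H)) \<and>
    p_morphism (dual_poset H) (dual_poset ?K) f \<and>
    f ` carrier (dual_poset H) = carrier (dual_poset ?K) \<and>
    (\<forall>x\<in>carrier ?K. upset_of H x = {q \<in> carrier (dual_poset H). f q \<in> upset_of ?K x})" for f
  have spec: "join_prime ?K (f q) \<and> (\<forall>x\<in>S. f q \<preceq> x \<longleftrightarrow> q \<preceq> x)"
    if "dual f" "join_prime H q" for f q
  proof -
    have 1: "join_prime ?K (f q)" using that unfolding dual_def by auto
    have "q \<in> upset_of H x \<longleftrightarrow> q \<in> {q \<in> carrier (dual_poset H). f q \<in> upset_of ?K x}" if "x \<in> S" for x
      using \<open>dual f\<close> that unfolding dual_def by auto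
    then show ?thesis using 1 that by auto
  qed
  obtain g where g: "\<And>q. join_prime H q \<Longrightarrow> join_prime ?K (g q)"
      "\<And>q x. join_prime H q \<Longrightarrow> x \<in> S \<Longrightarrow> q \<preceq> x \<longleftrightarrow> g q \<preceq> x"
  proof -
    have "\<exists>g. \<forall>q. join_prime H q \<longrightarrow> join_prime ?K (g q) \<and> (\<forall>x\<in>S. q \<preceq> x \<longleftrightarrow> g q \<preceq> x)"
      by (rule choice) (use least_above in blast)
    then show ?thesis using that by blast
  qed
  define f where "f = restrict g {p. join_prime H p}"
  have f: "\<And>q. join_prime H q \<Longrightarrow> join_prime ?K (f q)"
      "\<And>q x. join_prime H q \<Longrightarrow> x \<in> S \<Longrightarrow> q \<preceq> x \<longleftrightarrow> f q \<preceq> x"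
    using g by (auto simp: f_def)
  have fS: "\<And>q. join_prime H q \<Longrightarrow> f q \<in> S" using f sub_join_prime_closed by blast
  have mono: "f q \<preceq> f p" if "join_prime H p" "join_prime H q" "q \<preceq> p" for p q
  proof -
    have "p \<preceq> f p" using f(2)[of p "f p"] that fS le_refl sub_closed by blast
    then have "q \<preceq> f p" using le_trans[of q p "f p"] that fS sub_closed by (auto dest: join_prime_closed)
    then show ?thesis using f(2)[of q "f p"] that fS by blast
  qed
  \<comment> \<open>The back condition of a p-morphism. The dual order is reversed, so going up from
    \<open>u\<close> means finding a join-prime below \<open>u\<close>.\<close>
  have lift: "\<exists>w. join_prime H w \<and> w \<preceq> u \<and> f w = v"
    if u: "join_prime H u" and v: "join_prime ?K v" and le: "v \<preceq> f u" for u v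
  proof -
    have vS: "v \<in> S" using v sub_join_prime_closed by blast
    have "v \<preceq> x" if "x \<in> S" "u \<preceq> x" for x
    proof -
      have "f u \<preceq> x" using that f(2)[OF u, of x] by simp
      then show ?thesis
        using le le_trans sub_closed[OF vS] sub_closed[OF fS[OF u]] sub_closed[OF that(1)] by blast
    qed
    from join_prime_lift[OF v join_prime_closed[OF u] this]
    obtain w where w: "join_prime H w" "w \<preceq> u" "\<And>x. x \<in> S \<Longrightarrow> w \<preceq> x \<longleftrightarrow> v \<preceq> x"
      by auto
    have "f w = v"
      by (rule sub_join_prime_unique[OF fS[OF w(1)] vS]) (simp only: w(3) f(2)[OF w(1), symmetric])
    then show ?thesis using w by blast
  qed
  have surj: "\<exists>w. join_prime H w \<and> f w = v" if v: "join_prime ?K v" for v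
  proof -
    obtain w where w: "join_prime H w" "\<And>x. x \<in> S \<Longrightarrow> w \<preceq> x \<longleftrightarrow> v \<preceq> x"
      using join_prime_lift_one[OF v] by blast
    have "f w = v"
      by (rule sub_join_prime_unique[OF fS[OF w(1)] sub_join_prime_closed[OF v]])
        (simp only: w(2) f(2)[OF w(1), symmetric])
    then show ?thesis using w by blast
  qed
  have "dual f"
    unfolding dual_def
  proof (intro conjI ballI)
    show "f \<in> extensional (carrier (dual_poset H))" by (simp add: f_def)
    show "p_morphism (dual_poset H) (dual_poset ?K) f"
      unfolding p_morphism_def isotone_def
    proof (intro conjI ballI allI impI)
      show "f \<in> carrier (dual_poset H) \<rightarrow> carrier (dual_poset ?K)" using f by auto
      show "weak_partial_order (dual_poset H)" "weak_partial_order (dual_poset ?K)"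
        by (rule weak_partial_order_dual_poset sub.weak_partial_order_dual_poset)+
      show "f x \<sqsubseteq>\<^bsub>dual_poset ?K\<^esub> f y"
        if "x \<in> carrier (dual_poset H)" "y \<in> carrier (dual_poset H)" "x \<sqsubseteq>\<^bsub>dual_poset H\<^esub> y" for x y
        using that mono by (auto simp: dual_poset_def)
      show "\<exists>w\<in>carrier (dual_poset H). u \<sqsubseteq>\<^bsub>dual_poset H\<^esub> w \<and> f w = v"
        if "u \<in> carrier (dual_poset H)" "v \<in> carrier (dual_poset ?K)" "f u \<sqsubseteq>\<^bsub>dual_poset ?K\<^esub> v" for u v
        using that lift[of u v] by (auto simp: dual_poset_def)
    qed
    show "f ` carrier (dual_poset H) = carrier (dual_poset ?K)"
      using f(1) surj by (auto simp: image_iff)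
    show "upset_of H x = {q \<in> carrier (dual_poset H). f q \<in> upset_of ?K x}" if "x \<in> carrier ?K" for x
      using that f by auto
  qed
  \<comment> \<open>The inverse image clause already fixes the values at points, as it determines
    which elements of \<open>S\<close> lie above them. Extensionality fixes the rest.\<close>
  moreover have "h = f" if h: "dual h" for h
  proof
    fix q
    show "h q = f q"
    proof (cases "join_prime H q")
      case True
      note h' = spec[OF h True]
      have "h q \<preceq> x \<longleftrightarrow> f q \<preceq> x" if "x \<in> S" for x
        using h' f(2)[OF True that] that by simp
      then show ?thesis
        using h' by (intro sub_join_prime_unique fS True sub_join_prime_closed) auto
    next
      case False
      then show ?thesis using h by (auto simp: dual_def f_def extensional_def)
    qed
  qed
  ultimately have "dual (dual_map ?K H)"
    unfolding dual_map_def dual_def[symmetric] by (rule theI)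
  from spec[OF this assms]
  show "join_prime ?K (dual_map ?K H q)"
    and "x \<in> S \<Longrightarrow> dual_map ?K H q \<preceq> x \<longleftrightarrow> q \<preceq> x"
    by auto
qed

end


section \<open>Automorphism groups and pointwise convergence\<close>

text \<open>Stated for an arbitrary binary operation so that it covers meet, join and implication;
  complementation is passed as an operation that ignores its second argument.\<close>

lemma inv_into_preserves_op:
  assumes "bij_betw f S S"
    and "\<And>x y. x \<in> S \<Longrightarrow> y \<in> S \<Longrightarrow> op x y \<in> S"
    and "\<And>x y. x \<in> S \<Longrightarrow> y \<in> S \<Longrightarrow> f (op x y) = op (f x) (f y)"
    and "x \<in> S" "y \<in> S"
  shows "inv_into S f (op x y) = op (inv_into S f x) (inv_into S f y)"
proof -
  have inv: "inv_into S f z \<in> S" "f (inv_into S f z) = z" if "z \<in> S" for z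
    using assms(1) that by (auto simp: bij_betw_def inv_into_into f_inv_into_f)
  have "inj_on f S" using assms(1) by (simp add: bij_betw_def)
  then show ?thesis
    using assms(3)[OF inv(1)[OF assms(4)] inv(1)[OF assms(5)]]
    by (intro inv_into_f_eq) (simp_all add: inv assms)
qed

lemma inv_into_preserves_const:
  assumes "bij_betw f S S" "c \<in> S" "f c = c"
  shows "inv_into S f c = c"
  using assms by (intro inv_into_f_eq) (simp_all add: bij_betw_def)

lemma subgroup_heyting_aut:
  assumes "heyting_algebra H"
  shows "subgroup (heyting_aut H) (BijGroup (carrier H))"
proof -
  interpret heyting_algebra H by fact
  interpret bij: group "BijGroup (carrier H)" by (rule group_BijGroup)
  show ?thesis
  proof (rule bij.subgroupI)
    show "heyting_aut H \<subseteq> carrier (BijGroup (carrier H))"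
      by (auto simp: heyting_aut_def BijGroup_def)
    have "(\<lambda>x\<in>carrier H. x) \<in> heyting_aut H"
      using id_Bij[of "carrier H"]
      by (simp add: heyting_aut_def heyting_iso_def Bij_def zero_closed one_closed meet_closed
          join_closed imp_closed)
    then show "heyting_aut H \<noteq> {}" by blast
  next
    fix f assume f: "f \<in> heyting_aut H"
    then have bij: "f \<in> Bij (carrier H)" "bij_betw f (carrier H) (carrier H)"
      by (auto simp: heyting_aut_def Bij_def)
    note pres = inv_into_preserves_op[OF bij(2)] inv_into_preserves_const[OF bij(2)]
    have "restrict (inv_into (carrier H) f) (carrier H) \<in> heyting_aut H"
      using f restrict_inv_into_Bij[OF bij(1)]
      by (auto simp: heyting_aut_def heyting_iso_def Bij_def zero_closed one_closed meet_closed
          join_closed imp_closed intro!: pres)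
    then show "inv\<^bsub>BijGroup (carrier H)\<^esub> f \<in> heyting_aut H"
      using inv_BijGroup[OF bij(1)] by (simp add: restrict_def)
  next
    fix f g assume fg: "f \<in> heyting_aut H" "g \<in> heyting_aut H"
    then have bij: "f \<in> Bij (carrier H)" "g \<in> Bij (carrier H)"
      by (auto simp: heyting_aut_def)
    have "g x \<in> carrier H" if "x \<in> carrier H" for x
      using bij(2) that by (auto simp: Bij_def dest: bij_betwE)
    then have "compose (carrier H) f g \<in> heyting_aut H"
      using fg compose_Bij[OF bij]
      by (simp add: heyting_aut_def heyting_iso_def Bij_def compose_def zero_closed one_closed
          meet_closed join_closed imp_closed)
    then show "f \<otimes>\<^bsub>BijGroup (carrier H)\<^esub> g \<in> heyting_aut H"
      using bij by (simp add: BijGroup_def)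
  qed
qed

text \<open>The record \<open>boolean\<close> carries no axioms. Closure of the carrier under the
  operations is what makes identity, inverses and composites preserve them.\<close>

lemma subgroup_boolean_aut:
  assumes closed: "lzero B \<in> carrier B" "lone B \<in> carrier B"
    "\<And>x. x \<in> carrier B \<Longrightarrow> bcompl B x \<in> carrier B"
    "\<And>x y. x \<in> carrier B \<Longrightarrow> y \<in> carrier B \<Longrightarrow> x \<curlywedge>\<^bsub>B\<^esub> y \<in> carrier B"
    "\<And>x y. x \<in> carrier B \<Longrightarrow> y \<in> carrier B \<Longrightarrow> x \<curlyvee>\<^bsub>B\<^esub> y \<in> carrier B"
  shows "subgroup (boolean_aut B) (BijGroup (carrier B))"
proof -
  interpret group "BijGroup (carrier B)" by (rule group_BijGroup)
  show ?thesis
  proof (rule subgroupI)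
    show "boolean_aut B \<subseteq> carrier (BijGroup (carrier B))"
      by (auto simp: boolean_aut_def BijGroup_def)
    have "(\<lambda>x\<in>carrier B. x) \<in> boolean_aut B"
      using id_Bij[of "carrier B"] by (simp add: boolean_aut_def boolean_iso_def Bij_def closed)
    then show "boolean_aut B \<noteq> {}" by blast
  next
    fix f assume f: "f \<in> boolean_aut B"
    then have bij: "f \<in> Bij (carrier B)" "bij_betw f (carrier B) (carrier B)"
      by (auto simp: boolean_aut_def Bij_def)
    note pres = inv_into_preserves_op[OF bij(2)]
      inv_into_preserves_op[OF bij(2), of "\<lambda>x _. bcompl B x"] inv_into_preserves_const[OF bij(2)]
    have "restrict (inv_into (carrier B) f) (carrier B) \<in> boolean_aut B"
      using f restrict_inv_into_Bij[OF bij(1)]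
      by (auto simp: boolean_aut_def boolean_iso_def Bij_def closed intro!: pres)
    then show "inv\<^bsub>BijGroup (carrier B)\<^esub> f \<in> boolean_aut B"
      using inv_BijGroup[OF bij(1)] by (simp add: restrict_def)
  next
    fix f g assume fg: "f \<in> boolean_aut B" "g \<in> boolean_aut B"
    then have bij: "f \<in> Bij (carrier B)" "g \<in> Bij (carrier B)"
      by (auto simp: boolean_aut_def)
    have "g x \<in> carrier B" if "x \<in> carrier B" for x
      using bij(2) that by (auto simp: Bij_def dest: bij_betwE)
    then have "compose (carrier B) f g \<in> boolean_aut B"
      using fg compose_Bij[OF bij]
      by (simp add: boolean_aut_def boolean_iso_def Bij_def compose_def closed)
    then show "f \<otimes>\<^bsub>BijGroup (carrier B)\<^esub> g \<in> boolean_aut B"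
      using bij by (simp add: BijGroup_def)
  qed
qed

section \<open>Continuity in the topology of pointwise convergence\<close>

lemma topspace_pointwise_topology:
  "G \<subseteq> S \<rightarrow>\<^sub>E S \<Longrightarrow> topspace (pointwise_topology S G) = G"
  by (auto simp: pointwise_topology_def)

text \<open>Continuity may be checked one coordinate \<open>t\<close> at a time. The coordinate has
  discrete values and is constant on the basic open sets that prescribe a map on \<open>K\<close>.
  The set \<open>K\<close> depends on \<open>t\<close> but not on the map, a uniform form that fits
  both directions of the homeomorphism.\<close>

lemma continuous_map_pointwise_topology:
  assumes G: "G \<subseteq> S \<rightarrow>\<^sub>E S" and G': "G' \<subseteq> T \<rightarrow>\<^sub>E T"
    and \<Phi>: "\<And>f. f \<in> G \<Longrightarrow> \<Phi> f \<in> G'"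
    and loc: "\<And>t. t \<in> T \<Longrightarrow> \<exists>K. finite K \<and> K \<subseteq> S \<and>
      (\<forall>f\<in>G. \<forall>f'\<in>G. (\<forall>x\<in>K. f x = f' x) \<longrightarrow> \<Phi> f t = \<Phi> f' t)"
  shows "continuous_map (pointwise_topology S G) (pointwise_topology T G') \<Phi>"
proof -
  have nbhd: "openin (pointwise_topology S G) {f' \<in> G. \<forall>x\<in>K. f' x = f x}"
    if "finite K" "K \<subseteq> S" "f \<in> G" for K f
  proof -
    \<comment> \<open>Coordinates in \<open>K\<close> are pinned to the value of \<open>f\<close>
      and all others are free, so only finitely many factors are proper subsets.\<close>
    let ?W = "\<Pi>\<^sub>E x\<in>S. if x \<in> K then {f x} else S"
    have "finite {x \<in> S. (if x \<in> K then {f x} else S) \<noteq> topspace (discrete_topology S)}"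
      by (rule finite_subset[OF _ that(1)]) auto
    moreover have "f x \<in> S" if "x \<in> K" for x using that G \<open>K \<subseteq> S\<close> \<open>f \<in> G\<close> by blast
    ultimately have "openin (product_topology (\<lambda>_. discrete_topology S) S) ?W"
      by (auto simp: openin_PiE_gen)
    moreover have "{f' \<in> G. \<forall>x\<in>K. f' x = f x} = ?W \<inter> G"
    proof
      show "{f' \<in> G. \<forall>x\<in>K. f' x = f x} \<subseteq> ?W \<inter> G"
      proof (intro subsetI IntI)
        fix f' assume f': "f' \<in> {f' \<in> G. \<forall>x\<in>K. f' x = f x}"
        then have "f' \<in> S \<rightarrow>\<^sub>E S" using G by blast
        then show "f' \<in> ?W" using f' by (simp add: PiE_iff)
      qed simp
      show "?W \<inter> G \<subseteq> {f' \<in> G. \<forall>x\<in>K. f' x = f x}"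
      proof
        fix f' assume f': "f' \<in> ?W \<inter> G"
        have "f' x = f x" if "x \<in> K" for x
        proof -
          have "x \<in> S" using that \<open>K \<subseteq> S\<close> by blast
          then show ?thesis
            using PiE_mem[of f' S "\<lambda>x. if x \<in> K then {f x} else S" x] f' that by simp
        qed
        then show "f' \<in> {f' \<in> G. \<forall>x\<in>K. f' x = f x}" using f' by simp
      qed
    qed
    ultimately show ?thesis unfolding pointwise_topology_def openin_subtopology by blast
  qed
  have "continuous_map (pointwise_topology S G) (discrete_topology T) (\<lambda>f. \<Phi> f t)" if t: "t \<in> T" for t
  proof -
    obtain K where K: "finite K" "K \<subseteq> S"
      "\<forall>f\<in>G. \<forall>f'\<in>G. (\<forall>x\<in>K. f x = f' x) \<longrightarrow> \<Phi> f t = \<Phi> f' t"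
      using loc[OF t] by (elim exE conjE)
    have "openin (pointwise_topology S G) {f \<in> G. \<Phi> f t \<in> V}" for V
    proof (subst openin_subopen, intro ballI)
      fix f assume f: "f \<in> {f \<in> G. \<Phi> f t \<in> V}"
      have "\<Phi> f' t \<in> V" if "f' \<in> G" "\<forall>x\<in>K. f' x = f x" for f'
        using K(3)[rule_format, of f' f] that f by simp
      then have "{f' \<in> G. \<forall>x\<in>K. f' x = f x} \<subseteq> {f \<in> G. \<Phi> f t \<in> V}" by blast
      then show "\<exists>W. openin (pointwise_topology S G) W \<and> f \<in> W \<and> W \<subseteq> {f \<in> G. \<Phi> f t \<in> V}"
        using nbhd[OF K(1,2), of f] f by (intro exI[of _ "{f' \<in> G. \<forall>x\<in>K. f' x = f x}"]) simp
    qed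
    moreover have "\<Phi> f t \<in> T" if "f \<in> G" for f using \<Phi>[OF that] G' t by blast
    ultimately show ?thesis
      by (auto simp: continuous_map_def topspace_pointwise_topology[OF G])
  qed
  moreover have "\<Phi> ` G \<subseteq> extensional T" using \<Phi> G' by (auto simp: PiE_def)
  ultimately show ?thesis
    unfolding pointwise_topology_def[of T]
    by (auto simp: continuous_map_in_subtopology continuous_map_componentwise
        topspace_pointwise_topology[OF G] \<Phi>)
qed


section \<open>Prime filters of the union of a chain\<close>

locale heyting_chain = heyting_algebra L for L :: "'a heyting" (structure) +
  fixes Ls :: "nat \<Rightarrow> 'a set"
  assumes chain: "finite_subalgebra_chain L Ls"
begin

abbreviation stage :: "nat \<Rightarrow> 'a heyting"
  where "stage i \<equiv> substructure L (Ls i)"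

abbreviation P :: "nat \<Rightarrow> 'a set"
  where "P \<equiv> stage_points L Ls"

lemma stage_mono: "i \<le> j \<Longrightarrow> Ls i \<subseteq> Ls j"
  by (rule lift_Suc_mono_le) (use chain in \<open>simp_all add: finite_subalgebra_chain_def\<close>)

lemma subuniverse_stage: "subuniverse L (Ls i)"
  using chain by (simp add: finite_subalgebra_chain_def)

lemma finite_stage: "finite (Ls i)"
  using chain by (simp add: finite_subalgebra_chain_def)

lemma stage_closed: "x \<in> Ls i \<Longrightarrow> x \<in> carrier L"
  using subuniverse_stage by (auto simp: subuniverse_def)

lemma mem_some_stage: "x \<in> carrier L \<Longrightarrow> \<exists>i. x \<in> Ls i"
  using chain by (auto simp: finite_subalgebra_chain_def)

lemma finite_subset_some_stage:
  assumes "finite X" "X \<subseteq> carrier L"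
  shows "\<exists>i. X \<subseteq> Ls i"
  using assms
proof (induction X)
  case (insert x X)
  then obtain i where "X \<subseteq> Ls i" by auto
  moreover obtain j where "x \<in> Ls j" using mem_some_stage[of x] insert.prems by auto
  ultimately have "insert x X \<subseteq> Ls (max i j)"
    using stage_mono[of i "max i j"] stage_mono[of j "max i j"] by auto
  then show ?case by blast
qed simp

text \<open>The case \<open>i = j\<close> is deliberately included: a stage viewed as an extension
  of itself yields \<open>stage_point_unique\<close>.\<close>

lemma stage_extension: "i \<le> j \<Longrightarrow> finite_heyting_extension (stage j) (Ls i)"
  using subuniverse_stage[of i] stage_mono[of i j] finite_stage
  by (intro finite_heyting_extension.intro heyting_algebra_substructure subuniverse_stage
      finite_heyting_extension_axioms.intro) (auto simp: subuniverse_def)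

lemma mem_stage_points: "p \<in> P i \<longleftrightarrow> join_prime (stage i) p"
  by (simp add: stage_points_def)

lemma stage_points_in_stage: "p \<in> P i \<Longrightarrow> p \<in> Ls i"
  by (simp add: mem_stage_points join_prime_def)

lemma finite_stage_points: "finite (P i)"
  using finite_stage stage_points_in_stage by (meson finite_subset subsetI)

lemma stage_point_unique:
  assumes "p \<in> P i" "p' \<in> P i" "\<And>x. x \<in> Ls i \<Longrightarrow> p \<preceq> x \<longleftrightarrow> p' \<preceq> x"
  shows "p = p'"
  using finite_heyting_extension.sub_join_prime_unique[OF stage_extension[OF order_refl], of p i p']
    assms stage_points_in_stage by simp

lemma dual_map_stage:
  assumes "q \<in> P (Suc i)"
  shows "dual_map (stage i) (stage (Suc i)) q \<in> P i"
    and "x \<in> Ls i \<Longrightarrow> dual_map (stage i) (stage (Suc i)) q \<preceq> x \<longleftrightarrow> q \<preceq> x"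
  using finite_heyting_extension.dual_map_spec(1)[OF stage_extension[of i "Suc i"], of q]
    finite_heyting_extension.dual_map_spec(2)[OF stage_extension[of i "Suc i"], of q x] assms
  by (simp_all add: mem_stage_points)

lemma stage_point_lift:
  assumes "p \<in> P i"
  shows "\<exists>q\<in>P (Suc i). \<forall>x\<in>Ls i. q \<preceq> x \<longleftrightarrow> p \<preceq> x"
  using finite_heyting_extension.join_prime_lift_one[OF stage_extension[of i "Suc i"], of p] assms
  by (auto simp: mem_stage_points)

text \<open>The equivalences say that membership in \<open>F\<close> is a bounded lattice
  homomorphism to the two-element lattice. In this form upward closure is part of the meet clause,
  and preimages under automorphisms are handled by rewriting.\<close>

definition prime_filters :: "'a set set"
  where "prime_filters = {F. F \<subseteq> carrier L \<and> lone L \<in> F \<and> lzero L \<notin> F \<and>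
    (\<forall>x\<in>carrier L. \<forall>y\<in>carrier L.
      (x \<curlywedge> y \<in> F \<longleftrightarrow> x \<in> F \<and> y \<in> F) \<and> (x \<curlyvee> y \<in> F \<longleftrightarrow> x \<in> F \<or> y \<in> F))}"

lemma prime_filter_upward:
  assumes "F \<in> prime_filters" "x \<in> F" "x \<preceq> y" "y \<in> carrier L"
  shows "y \<in> F"
proof -
  have "x \<in> carrier L" using assms by (auto simp: prime_filters_def)
  moreover have "x \<curlywedge> y \<in> F" using assms by (simp add: lle_def)
  ultimately show ?thesis using assms by (auto simp: prime_filters_def)
qed

text \<open>The generator of the principal filter \<open>F \<inter> Ls i\<close>.\<close>
definition trace :: "nat \<Rightarrow> 'a set \<Rightarrow> 'a"
  where "trace i F = (THE p. p \<in> P i \<and> (\<forall>x\<in>Ls i. x \<in> F \<longleftrightarrow> p \<preceq> x))"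

lemma trace_unique:
  assumes "p \<in> P i" "\<And>x. x \<in> Ls i \<Longrightarrow> x \<in> F \<longleftrightarrow> p \<preceq> x"
  shows "trace i F = p"
  unfolding trace_def
proof (rule the_equality)
  fix p' assume "p' \<in> P i \<and> (\<forall>x\<in>Ls i. x \<in> F \<longleftrightarrow> p' \<preceq> x)"
  then show "p' = p" using assms by (intro stage_point_unique) auto
qed (use assms in auto)

lemma trace_exists:
  assumes F: "F \<in> prime_filters"
  shows "\<exists>p\<in>P i. \<forall>x\<in>Ls i. x \<in> F \<longleftrightarrow> p \<preceq> x"
proof -
  let ?U = "F \<inter> Ls i"
  have sub: "subuniverse L (Ls i)" by (rule subuniverse_stage)
  have Fc: "F \<subseteq> carrier L" using F by (simp add: prime_filters_def)
  have "x \<curlywedge> y \<in> ?U" if "x \<in> ?U" "y \<in> ?U" for x y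
  proof -
    have "x \<in> carrier L" "y \<in> carrier L" using that Fc by auto
    then show ?thesis using that F sub by (simp add: prime_filters_def subuniverse_def)
  qed
  moreover have "lone L \<in> ?U" using F sub by (simp add: prime_filters_def subuniverse_def)
  ultimately obtain p where p: "p \<in> ?U" "\<forall>x\<in>?U. p \<preceq> x"
    using finite_meet_closed_has_least[of ?U] finite_stage[of i] Fc by blast
  have iff: "x \<in> F \<longleftrightarrow> p \<preceq> x" if "x \<in> Ls i" for x
    using p that prime_filter_upward[OF F, of p x] stage_closed[OF that] by auto
  have "p \<preceq> x \<or> p \<preceq> y" if "x \<in> Ls i" "y \<in> Ls i" "p \<preceq> x \<curlyvee> y" for x y
  proof -
    have "x \<curlyvee> y \<in> Ls i" using that sub by (simp add: subuniverse_def)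
    then have "x \<curlyvee> y \<in> F" using iff that by simp
    then have "x \<in> F \<or> y \<in> F" using F stage_closed that by (simp add: prime_filters_def)
    then show ?thesis using iff that by simp
  qed
  moreover have "p \<noteq> lzero L" using p F by (auto simp: prime_filters_def)
  ultimately have "p \<in> P i" using p by (auto simp: mem_stage_points join_prime_def)
  then show ?thesis using iff by blast
qed

lemma
  assumes "F \<in> prime_filters"
  shows trace_in_stage_points: "trace i F \<in> P i"
    and trace_le_iff: "x \<in> Ls i \<Longrightarrow> trace i F \<preceq> x \<longleftrightarrow> x \<in> F"
proof -
  obtain p where "p \<in> P i" "\<forall>x\<in>Ls i. x \<in> F \<longleftrightarrow> p \<preceq> x" using trace_exists[OF assms] by blast
  moreover from this have "trace i F = p" by (intro trace_unique) auto
  ultimately show "trace i F \<in> P i" "x \<in> Ls i \<Longrightarrow> trace i F \<preceq> x \<longleftrightarrow> x \<in> F" by auto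
qed

text \<open>The dual map does not change which elements of the smaller stage lie above a point, so
  its value has the property that characterises the trace. This makes the traces of one filter a
  coherent sequence.\<close>

lemma dual_map_trace:
  assumes F: "F \<in> prime_filters"
  shows "dual_map (stage i) (stage (Suc i)) (trace (Suc i) F) = trace i F"
proof (rule trace_unique[symmetric])
  show "dual_map (stage i) (stage (Suc i)) (trace (Suc i) F) \<in> P i"
    using dual_map_stage(1) trace_in_stage_points F by blast
  fix x assume "x \<in> Ls i"
  moreover then have "x \<in> Ls (Suc i)" using stage_mono[of i "Suc i"] by auto
  ultimately show "x \<in> F \<longleftrightarrow> dual_map (stage i) (stage (Suc i)) (trace (Suc i) F) \<preceq> x"
    using dual_map_stage(2) trace_in_stage_points trace_le_iff F by simp
qed

text \<open>Lifting \<open>p\<close> step by step along the chain yields a prime filter above it.\<close>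
lemma trace_surj:
  assumes "p \<in> P i"
  shows "\<exists>F\<in>prime_filters. trace i F = p"
proof -
  \<comment> \<open>The clause on \<open>n = 0\<close> anchors the sequence at \<open>p\<close>;
    dependent choice would otherwise only put its start somewhere in \<open>P i\<close>.\<close>
  have "\<exists>s. \<forall>n. (s n \<in> P (i + n) \<and> (n = 0 \<longrightarrow> s n = p)) \<and> (\<forall>x\<in>Ls (i + n). s (Suc n) \<preceq> x \<longleftrightarrow> s n \<preceq> x)"
  proof (rule dependent_nat_choice)
    show "\<exists>q. q \<in> P (i + 0) \<and> (0 = (0::nat) \<longrightarrow> q = p)" using assms by auto
    show "\<exists>r. (r \<in> P (i + Suc n) \<and> (Suc n = 0 \<longrightarrow> r = p)) \<and> (\<forall>x\<in>Ls (i + n). r \<preceq> x \<longleftrightarrow> q \<preceq> x)"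
      if "q \<in> P (i + n) \<and> (n = 0 \<longrightarrow> q = p)" for q n
      using stage_point_lift[of q "i + n"] that by auto
  qed
  then obtain s where s: "\<And>n. s n \<in> P (i + n)" "s 0 = p"
      "\<And>n x. x \<in> Ls (i + n) \<Longrightarrow> s (Suc n) \<preceq> x \<longleftrightarrow> s n \<preceq> x"
    by blast
  have up: "s (n + k) \<preceq> x \<longleftrightarrow> s n \<preceq> x" if "x \<in> Ls (i + n)" for n k x
  proof (induction k)
    case (Suc k)
    have "x \<in> Ls (i + (n + k))" using that stage_mono[of "i + n" "i + (n + k)"] by auto
    then show ?case using s(3) Suc by simp
  qed simp
  \<comment> \<open>\<open>F\<close> is the union of the filters generated by \<open>s n\<close> in
    \<open>Ls (i + n)\<close>. By \<open>up\<close> each of them is the restriction of the later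
    ones, so membership can be tested at any stage that contains the element.\<close>
  define F where "F = {x. \<exists>n. x \<in> Ls (i + n) \<and> s n \<preceq> x}"
  have F_iff: "x \<in> F \<longleftrightarrow> s n \<preceq> x" if x: "x \<in> Ls (i + n)" for x n
  proof -
    have "s m \<preceq> x \<longleftrightarrow> s n \<preceq> x" if "x \<in> Ls (i + m)" for m
      using up[OF that, of n] up[OF x, of m] unfolding add.commute[of m n] by blast
    then show ?thesis using x unfolding F_def by blast
  qed
  have Fc: "F \<subseteq> carrier L" using stage_closed by (auto simp: F_def)
  have common: "\<exists>n. x \<in> Ls (i + n) \<and> y \<in> Ls (i + n)" if xy: "x \<in> carrier L" "y \<in> carrier L" for x y
  proof -
    obtain j where "{x, y} \<subseteq> Ls j" using finite_subset_some_stage[of "{x, y}"] xy by auto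
    then show ?thesis using stage_mono[of j "i + j"] by auto
  qed
  have jp: "join_prime (stage (i + n)) (s n)" for n using s(1) mem_stage_points by blast
  have sc: "s n \<in> carrier L" for n using s(1) stage_points_in_stage stage_closed by blast
  have "(x \<curlywedge> y \<in> F \<longleftrightarrow> x \<in> F \<and> y \<in> F) \<and> (x \<curlyvee> y \<in> F \<longleftrightarrow> x \<in> F \<or> y \<in> F)"
    if xy: "x \<in> carrier L" "y \<in> carrier L" for x y
  proof -
    obtain n where n: "x \<in> Ls (i + n)" "y \<in> Ls (i + n)" using common xy by blast
    then have n': "x \<curlywedge> y \<in> Ls (i + n)" "x \<curlyvee> y \<in> Ls (i + n)"
      using subuniverse_stage by (auto simp: subuniverse_def)
    have "s n \<preceq> x \<curlywedge> y \<longleftrightarrow> s n \<preceq> x \<and> s n \<preceq> y" using le_meet_iff xy sc by simp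
    moreover have "s n \<preceq> x \<curlyvee> y \<Longrightarrow> s n \<preceq> x \<or> s n \<preceq> y" using jp[of n] n by (simp add: join_prime_def)
    moreover have "s n \<preceq> x \<curlyvee> y" if "s n \<preceq> x \<or> s n \<preceq> y"
      using that le_trans[OF _ le_join1, of "s n" x y] le_trans[OF _ le_join2, of "s n" y x]
        xy sc by (auto simp: join_closed)
    ultimately show ?thesis using F_iff[OF n(1)] F_iff[OF n(2)] F_iff[OF n'(1)] F_iff[OF n'(2)] by blast
  qed
  moreover have "lone L \<in> F"
    using F_iff[of "lone L" 0] subuniverse_stage[of i] one_greatest[OF sc] by (simp add: subuniverse_def)
  moreover have "lzero L \<notin> F"
  proof -
    have "s 0 \<noteq> lzero L" using jp[of 0] by (simp add: join_prime_def)
    then have "\<not> s 0 \<preceq> lzero L" using le_antisym[OF _ zero_least] sc zero_closed by blast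
    then show ?thesis using F_iff[of "lzero L" 0] subuniverse_stage[of i] by (simp add: subuniverse_def)
  qed
  ultimately have "F \<in> prime_filters" using Fc by (simp add: prime_filters_def)
  moreover have "trace i F = p" using F_iff[of _ 0] s(2) assms by (intro trace_unique) auto
  ultimately show ?thesis by blast
qed

text \<open>This equivalence allows \<open>clopens\<close> to be defined without reference to points
  of the dual posets.\<close>

lemma trace_eq_iff:
  assumes "F \<in> prime_filters" "G \<in> prime_filters"
  shows "trace i F = trace i G \<longleftrightarrow> F \<inter> Ls i = G \<inter> Ls i"
proof
  assume "trace i F = trace i G"
  then show "F \<inter> Ls i = G \<inter> Ls i"
    using trace_le_iff[OF assms(1), of _ i] trace_le_iff[OF assms(2), of _ i] by auto
next
  assume eq: "F \<inter> Ls i = G \<inter> Ls i"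
  show "trace i F = trace i G"
  proof (rule trace_unique)
    show "trace i G \<in> P i" using trace_in_stage_points assms by blast
    fix x assume "x \<in> Ls i"
    then show "x \<in> F \<longleftrightarrow> trace i G \<preceq> x" using eq trace_le_iff[OF assms(2)] by blast
  qed
qed


section \<open>The limit Boolean algebra as a field of sets of prime filters\<close>

text \<open>The preimage of \<open>A\<close> under the projection from prime filters to the points
  of stage \<open>i\<close>, as for cylinder sets in an inverse limit.\<close>

definition cylinder :: "nat \<Rightarrow> 'a set \<Rightarrow> 'a set set"
  where "cylinder i A = {F \<in> prime_filters. trace i F \<in> A}"

text \<open>Since every point is a trace, \<open>A\<close> is recovered as the set of traces of its
  cylinder.\<close>

lemma cylinder_inject:
  assumes "A \<subseteq> P i" "A' \<subseteq> P i" "cylinder i A = cylinder i A'"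
  shows "A = A'"
proof -
  have *: "A = trace i ` cylinder i A" if "A \<subseteq> P i" for A
  proof
    show "A \<subseteq> trace i ` cylinder i A"
    proof
      fix p assume "p \<in> A"
      moreover from this obtain F where "F \<in> prime_filters" "trace i F = p"
        using trace_surj \<open>A \<subseteq> P i\<close> by blast
      ultimately show "p \<in> trace i ` cylinder i A" by (auto simp: cylinder_def)
    qed
  qed (auto simp: cylinder_def)
  have "A = trace i ` cylinder i A'" using *[OF assms(1)] assms(3) by simp
  then show ?thesis using *[OF assms(2)] by simp
qed

lemma cylinder_stage_incl: "cylinder (i + n) (stage_incl L Ls i n A) = cylinder i A"
proof (induction n)
  case (Suc n)
  have "cylinder (i + Suc n) (stage_incl L Ls i (Suc n) A) = cylinder (i + n) (stage_incl L Ls i n A)"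
    using trace_in_stage_points dual_map_trace by (auto simp: cylinder_def)
  then show ?case using Suc by simp
qed simp

lemma stage_incl_subset: "A \<subseteq> P i \<Longrightarrow> stage_incl L Ls i n A \<subseteq> P (i + n)"
  by (cases n) auto

text \<open>Moving to a later stage leaves the cylinder unchanged, and at the common stage
  \<open>max i j\<close> cylinders determine subsets. Identification in the direct limit thus
  becomes equality of sets, from which transitivity is evident.\<close>

lemma limit_rel_iff:
  "((i, A), (j, A')) \<in> limit_rel L Ls \<longleftrightarrow> A \<subseteq> P i \<and> A' \<subseteq> P j \<and> cylinder i A = cylinder j A'"
  (is "?l \<longleftrightarrow> ?r")
proof
  assume ?l
  then obtain k where "A \<subseteq> P i" "A' \<subseteq> P j" "i \<le> k" "j \<le> k"
      "stage_incl L Ls i (k - i) A = stage_incl L Ls j (k - j) A'"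
    by (auto simp: limit_rel_def)
  then show ?r
    using cylinder_stage_incl[of i "k - i" A] cylinder_stage_incl[of j "k - j" A'] by simp
next
  assume r: ?r
  define k where "k = max i j"
  have k: "i \<le> k" "j \<le> k" by (auto simp: k_def)
  have "stage_incl L Ls i (k - i) A = stage_incl L Ls j (k - j) A'"
  proof (rule cylinder_inject)
    show "stage_incl L Ls i (k - i) A \<subseteq> P k" "stage_incl L Ls j (k - j) A' \<subseteq> P k"
      using r k stage_incl_subset[of A i "k - i"] stage_incl_subset[of A' j "k - j"] by simp_all
    show "cylinder k (stage_incl L Ls i (k - i) A) = cylinder k (stage_incl L Ls j (k - j) A')"
      using r k cylinder_stage_incl[of i "k - i" A] cylinder_stage_incl[of j "k - j" A'] by simp
  qed
  then show ?l using r k by (auto simp: limit_rel_def)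
qed

text \<open>The clopen sets of the prime filter space, seen as a subspace of the power set of
  \<open>L\<close>: membership is decided by finitely many elements of \<open>L\<close>. Stages are
  cofinal among finite subsets, so another chain would give the same family.\<close>

definition clopens :: "'a set set set"
  where "clopens = {U. U \<subseteq> prime_filters \<and>
    (\<exists>i. \<forall>F\<in>U. \<forall>G\<in>prime_filters. F \<inter> Ls i = G \<inter> Ls i \<longrightarrow> G \<in> U)}"

lemma cylinder_in_clopens: "cylinder i A \<in> clopens"
proof -
  have "G \<in> cylinder i A" if "F \<in> cylinder i A" "G \<in> prime_filters" "F \<inter> Ls i = G \<inter> Ls i" for F G
    using that trace_eq_iff[of F G i] by (simp add: cylinder_def)
  then show ?thesis unfolding clopens_def by (auto simp: cylinder_def)
qed

lemma clopens_cylinderE: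
  assumes "U \<in> clopens"
  obtains i A where "A \<subseteq> P i" "U = cylinder i A"
proof -
  obtain i where i: "U \<subseteq> prime_filters"
      "\<forall>F\<in>U. \<forall>G\<in>prime_filters. F \<inter> Ls i = G \<inter> Ls i \<longrightarrow> G \<in> U"
    using assms by (auto simp: clopens_def)
  have "U = cylinder i (trace i ` U)"
  proof
    show "U \<subseteq> cylinder i (trace i ` U)" using i by (auto simp: cylinder_def)
    show "cylinder i (trace i ` U) \<subseteq> U"
    proof
      fix G assume "G \<in> cylinder i (trace i ` U)"
      then obtain F where "G \<in> prime_filters" "F \<in> U" "trace i G = trace i F"
        by (auto simp: cylinder_def)
      moreover from this have "F \<in> prime_filters" using i(1) by blast
      ultimately have "F \<inter> Ls i = G \<inter> Ls i" using trace_eq_iff[of F G i] by simp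
      then show "G \<in> U" using i(2) \<open>F \<in> U\<close> \<open>G \<in> prime_filters\<close> by simp
    qed
  qed
  moreover have "trace i ` U \<subseteq> P i" using i trace_in_stage_points by auto
  ultimately show ?thesis using that by blast
qed

text \<open>The whole equivalence class of pairs that represent \<open>U\<close>. It is nonempty for
  \<open>U\<close> in \<open>clopens\<close>, and any member gives \<open>U\<close> back.\<close>

definition limit_point :: "'a set set \<Rightarrow> (nat \<times> 'a set) set"
  where "limit_point U = {(i, A). A \<subseteq> P i \<and> cylinder i A = U}"

lemma limit_class_eq: "A \<subseteq> P i \<Longrightarrow> limit_class L Ls i A = limit_point (cylinder i A)"
  by (auto simp: limit_class_def limit_point_def limit_rel_iff)

lemma limit_point_nonempty: "U \<in> clopens \<Longrightarrow> limit_point U \<noteq> {}"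
  by (erule clopens_cylinderE) (auto simp: limit_point_def)

lemma inj_limit_point: "inj_on limit_point clopens"
proof
  fix U V assume "U \<in> clopens" "V \<in> clopens" "limit_point U = limit_point V"
  moreover from this obtain z where "z \<in> limit_point U" using limit_point_nonempty by blast
  ultimately show "U = V" by (auto simp: limit_point_def)
qed

lemma cylinder_Int: "cylinder i (A \<inter> A') = cylinder i A \<inter> cylinder i A'"
  by (auto simp: cylinder_def)

lemma cylinder_Un: "cylinder i (A \<union> A') = cylinder i A \<union> cylinder i A'"
  by (auto simp: cylinder_def)

lemma cylinder_compl: "cylinder i (P i - A) = prime_filters - cylinder i A"
  using trace_in_stage_points by (auto simp: cylinder_def)

section \<open>Boolean operations of the limit as set operations\<close>

abbreviation B :: "(nat \<times> 'a set) set boolean"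
  where "B \<equiv> limit_boolean L Ls"

lemma carrier_B: "carrier B = limit_point ` clopens"
proof -
  have "carrier B = {limit_class L Ls i A | i A. A \<subseteq> P i}"
    by (auto simp: limit_boolean_def quotient_def limit_class_def)
  also have "\<dots> = {limit_point (cylinder i A) | i A. A \<subseteq> P i}"
    using limit_class_eq by blast
  also have "\<dots> = limit_point ` clopens"
    using cylinder_in_clopens by (blast elim: clopens_cylinderE)
  finally show ?thesis .
qed

text \<open>\<open>limit_op\<close> is a union over all pairs of representatives. Each pair
  contributes the same class and representatives exist, so the union is that class.\<close>

lemma limit_op_limit_point:
  assumes "U \<in> clopens" "V \<in> clopens"
    and "\<And>k A A'. A \<subseteq> P k \<Longrightarrow> A' \<subseteq> P k \<Longrightarrow>
      op A A' \<subseteq> P k \<and> cylinder k (op A A') = op' (cylinder k A) (cylinder k A')"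
  shows "limit_op L Ls op (limit_point U) (limit_point V) = limit_point (op' U V)"
proof -
  have "limit_class L Ls (max i j) (op (stage_incl L Ls i (max i j - i) A) (stage_incl L Ls j (max i j - j) A'))
      = limit_point (op' U V)" if "(i, A) \<in> limit_point U" "(j, A') \<in> limit_point V" for i A j A'
  proof -
    let ?k = "max i j"
    let ?A = "stage_incl L Ls i (?k - i) A" and ?A' = "stage_incl L Ls j (?k - j) A'"
    have "?A \<subseteq> P ?k" "?A' \<subseteq> P ?k"
      using that stage_incl_subset[of A i "?k - i"] stage_incl_subset[of A' j "?k - j"]
      by (simp_all add: limit_point_def)
    moreover have "cylinder ?k ?A = U" "cylinder ?k ?A' = V"
      using that cylinder_stage_incl[of i "?k - i" A] cylinder_stage_incl[of j "?k - j" A']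
      by (simp_all add: limit_point_def)
    ultimately show ?thesis using assms(3)[of ?A ?k ?A'] limit_class_eq by metis
  qed
  then have "(\<Union>(j, A')\<in>limit_point V. limit_class L Ls (max i j)
      (op (stage_incl L Ls i (max i j - i) A) (stage_incl L Ls j (max i j - j) A')))
      = limit_point (op' U V)" if "(i, A) \<in> limit_point U" for i A
    using that by (intro SUP_eq_const limit_point_nonempty assms(2)) auto
  then show ?thesis
    unfolding limit_op_def by (intro SUP_eq_const limit_point_nonempty assms(1)) auto
qed

lemma B_zero: "lzero B = limit_point {}"
  by (simp add: limit_boolean_def limit_class_eq cylinder_def)

lemma B_one: "lone B = limit_point prime_filters"
proof -
  have "cylinder 0 (P 0) = prime_filters" using trace_in_stage_points by (auto simp: cylinder_def)
  then show ?thesis by (simp add: limit_boolean_def limit_class_eq)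
qed

lemma B_meet:
  "\<lbrakk>U \<in> clopens; V \<in> clopens\<rbrakk> \<Longrightarrow> limit_point U \<curlywedge>\<^bsub>B\<^esub> limit_point V = limit_point (U \<inter> V)"
  by (simp add: limit_boolean_def limit_op_limit_point[where op' = "(\<inter>)"] cylinder_Int le_infI1)

lemma B_join:
  "\<lbrakk>U \<in> clopens; V \<in> clopens\<rbrakk> \<Longrightarrow> limit_point U \<curlyvee>\<^bsub>B\<^esub> limit_point V = limit_point (U \<union> V)"
  by (simp add: limit_boolean_def limit_op_limit_point[where op' = "(\<union>)"] cylinder_Un)

lemma B_compl:
  assumes "U \<in> clopens"
  shows "bcompl B (limit_point U) = limit_point (prime_filters - U)"
proof -
  have "limit_class L Ls i (P i - A) = limit_point (prime_filters - U)"
    if "(i, A) \<in> limit_point U" for i A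
    using that limit_class_eq[of "P i - A" i] cylinder_compl by (auto simp: limit_point_def)
  then show ?thesis
    unfolding limit_boolean_def boolean.simps
    by (intro SUP_eq_const limit_point_nonempty assms) auto
qed

lemma clopens_empty: "{} \<in> clopens"
  by (simp add: clopens_def)

lemma clopens_compl: "U \<in> clopens \<Longrightarrow> prime_filters - U \<in> clopens"
  by (metis clopens_cylinderE cylinder_compl cylinder_in_clopens)

lemma clopens_one: "prime_filters \<in> clopens"
  using clopens_compl[OF clopens_empty] by simp

lemma clopens_Int:
  assumes "U \<in> clopens" "V \<in> clopens"
  shows "U \<inter> V \<in> clopens"
proof -
  obtain i A j A' where A: "A \<subseteq> P i" "U = cylinder i A" "A' \<subseteq> P j" "V = cylinder j A'"
    using assms by (metis clopens_cylinderE)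
  let ?k = "max i j"
  have "U \<inter> V = cylinder ?k (stage_incl L Ls i (?k - i) A \<inter> stage_incl L Ls j (?k - j) A')"
    using A cylinder_stage_incl[of i "?k - i" A] cylinder_stage_incl[of j "?k - j" A']
    by (simp add: cylinder_Int)
  then show ?thesis using cylinder_in_clopens by simp
qed

lemma clopens_Un:
  assumes "U \<in> clopens" "V \<in> clopens"
  shows "U \<union> V \<in> clopens"
proof -
  have "U \<subseteq> prime_filters" "V \<subseteq> prime_filters" using assms by (auto simp: clopens_def)
  then have "U \<union> V = prime_filters - ((prime_filters - U) \<inter> (prime_filters - V))" by blast
  then show ?thesis using assms clopens_compl clopens_Int by simp
qed

section \<open>The copy of \<open>L\<close> in the limit and what it generates\<close>

definition filters_through :: "'a \<Rightarrow> 'a set set"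
  where "filters_through x = {F \<in> prime_filters. x \<in> F}"

lemma filters_through_cylinder:
  "x \<in> Ls i \<Longrightarrow> filters_through x = cylinder i (upset_of (stage i) x)"
  using trace_in_stage_points trace_le_iff
  by (auto simp: filters_through_def cylinder_def mem_stage_points)

lemma filters_through_clopen: "x \<in> carrier L \<Longrightarrow> filters_through x \<in> clopens"
  using mem_some_stage filters_through_cylinder cylinder_in_clopens by metis

lemma limit_embed_eq:
  assumes "x \<in> carrier L"
  shows "limit_embed L Ls x = limit_point (filters_through x)"
proof -
  have "x \<in> Ls (LEAST i. x \<in> Ls i)" using mem_some_stage[OF assms] by (metis LeastI)
  then show ?thesis
    by (simp add: limit_embed_def Let_def filters_through_cylinder limit_class_eq mem_stage_points
        subset_iff)
qed

text \<open>Separation by prime filters is reduced to a finite stage containing both elements: there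
  join-primes separate them, and every join-prime is the trace of a prime filter.\<close>

lemma inj_filters_through: "inj_on filters_through (carrier L)"
proof
  fix x y assume xy: "x \<in> carrier L" "y \<in> carrier L" and eq: "filters_through x = filters_through y"
  obtain i where i: "{x, y} \<subseteq> Ls i" using finite_subset_some_stage[of "{x, y}"] xy by auto
  interpret sub: heyting_algebra "stage i" using subuniverse_stage by (rule heyting_algebra_substructure)
  have "upset_of (stage i) x = upset_of (stage i) y"
    using eq filters_through_cylinder[of x i] filters_through_cylinder[of y i] i
    by (intro cylinder_inject[of _ i]) (auto simp: mem_stage_points)
  then have "\<And>q. join_prime (stage i) q \<Longrightarrow> q \<preceq> x \<longleftrightarrow> q \<preceq> y"
    by (auto simp: set_eq_iff)
  then have "x \<preceq> y" "y \<preceq> x"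
    using sub.join_prime_separation[of x y] sub.join_prime_separation[of y x] i finite_stage by auto
  then show "x = y" using le_antisym xy by blast
qed

lemma inj_limit_embed: "inj_on (limit_embed L Ls) (carrier L)"
proof
  fix x y assume "x \<in> carrier L" "y \<in> carrier L" "limit_embed L Ls x = limit_embed L Ls y"
  then show "x = y"
    using limit_embed_eq filters_through_clopen inj_onD[OF inj_limit_point] inj_onD[OF inj_filters_through]
    by metis
qed

lemma limit_embed_closed: "x \<in> carrier L \<Longrightarrow> limit_embed L Ls x \<in> carrier B"
  by (simp add: limit_embed_eq carrier_B filters_through_clopen)

text \<open>With \<open>m\<close> the largest element of the stage not above \<open>p\<close>,
  \<open>p \<in> F\<close> says that the trace is below \<open>p\<close> and
  \<open>m \<notin> F\<close> says that it is above \<open>p\<close>. Hence each point is a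
  difference of two elements of \<open>L\<close>.\<close>

lemma cylinder_singleton:
  assumes p: "p \<in> P i"
  shows "\<exists>m\<in>Ls i. cylinder i {p} = filters_through p \<inter> (prime_filters - filters_through m)"
proof -
  interpret sub: heyting_algebra "stage i" using subuniverse_stage by (rule heyting_algebra_substructure)
  obtain m where m: "m \<in> Ls i" "\<And>x. x \<in> Ls i \<Longrightarrow> x \<preceq> m \<longleftrightarrow> \<not> p \<preceq> x"
    using sub.join_prime_cut[of p] finite_stage p by (auto simp: mem_stage_points)
  have "trace i F = p \<longleftrightarrow> p \<in> F \<and> m \<notin> F" if F: "F \<in> prime_filters" for F
  proof -
    note t = stage_points_in_stage[OF trace_in_stage_points[OF F, of i]] stage_points_in_stage[OF p]
    have "m \<notin> F \<longleftrightarrow> p \<preceq> trace i F" using m t trace_le_iff[OF F] by auto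
    moreover have "p \<in> F \<longleftrightarrow> trace i F \<preceq> p" using t trace_le_iff[OF F] by auto
    ultimately show ?thesis
      using le_antisym[of p "trace i F"] stage_closed t le_refl[of p] by auto
  qed
  then show ?thesis using m(1) by (auto simp: cylinder_def filters_through_def)
qed

text \<open>The image of \<open>L\<close> generates the limit.\<close>
lemma clopens_induct [consumes 1, case_names embed compl Int Un]:
  assumes "U \<in> clopens"
    and "\<And>x. x \<in> carrier L \<Longrightarrow> Q (filters_through x)"
    and compl: "\<And>U. U \<in> clopens \<Longrightarrow> Q U \<Longrightarrow> Q (prime_filters - U)"
    and int: "\<And>U V. U \<in> clopens \<Longrightarrow> V \<in> clopens \<Longrightarrow> Q U \<Longrightarrow> Q V \<Longrightarrow> Q (U \<inter> V)"
    and un: "\<And>U V. U \<in> clopens \<Longrightarrow> V \<in> clopens \<Longrightarrow> Q U \<Longrightarrow> Q V \<Longrightarrow> Q (U \<union> V)"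
  shows "Q U"
proof -
  obtain i A where A: "A \<subseteq> P i" "U = cylinder i A" using assms(1) by (rule clopens_cylinderE)
  have "finite A" using A(1) finite_stage_points finite_subset by blast
  then have "Q (cylinder i A)" using A(1)
  proof (induction A)
    case empty
    \<comment> \<open>The empty union is itself an element of \<open>L\<close>, since no prime
      filter contains zero.\<close>
    have "filters_through (lzero L) = cylinder i {}"
      by (auto simp: filters_through_def cylinder_def prime_filters_def)
    then show ?case using assms(2)[OF zero_closed] by simp
  next
    case (insert p A)
    then have p: "p \<in> P i" by simp
    obtain m where m: "m \<in> Ls i" "cylinder i {p} = filters_through p \<inter> (prime_filters - filters_through m)"
      using cylinder_singleton[OF p] by blast
    have "p \<in> carrier L" "m \<in> carrier L" using m p stage_points_in_stage stage_closed by blast+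
    then have "Q (cylinder i {p})"
      using m(2) by (simp add: assms(2) compl int filters_through_clopen clopens_compl)
    then have "Q (cylinder i {p} \<union> cylinder i A)"
      using insert by (intro un cylinder_in_clopens) auto
    then show ?case by (simp flip: cylinder_Un)
  qed
  then show ?thesis using A by simp
qed


section \<open>The action of automorphisms on prime filters\<close>

definition pull :: "('a \<Rightarrow> 'a) \<Rightarrow> 'a set \<Rightarrow> 'a set"
  where "pull f G = {x \<in> carrier L. f x \<in> G}"

text \<open>Taking preimages twice, of elements and then of filters, makes the action covariant: it
  respects the order of composition and sends the set of filters through \<open>x\<close> to that of
  filters through \<open>f x\<close>.\<close>

definition act :: "('a \<Rightarrow> 'a) \<Rightarrow> 'a set set \<Rightarrow> 'a set set"
  where "act f U = {G \<in> prime_filters. pull f G \<in> U}"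

definition extend :: "('a \<Rightarrow> 'a) \<Rightarrow> (nat \<times> 'a set) set \<Rightarrow> (nat \<times> 'a set) set"
  where "extend f = (\<lambda>X\<in>carrier B. limit_point (act f (the_inv_into clopens limit_point X)))"

lemma extend_limit_point: "U \<in> clopens \<Longrightarrow> extend f (limit_point U) = limit_point (act f U)"
  by (simp add: extend_def carrier_B the_inv_into_f_f[OF inj_limit_point])

lemma aut_closed: "f \<in> heyting_aut L \<Longrightarrow> x \<in> carrier L \<Longrightarrow> f x \<in> carrier L"
  by (auto simp: heyting_aut_def Bij_def dest: bij_betwE)

lemma pull_prime_filter:
  assumes "f \<in> heyting_aut L" "G \<in> prime_filters"
  shows "pull f G \<in> prime_filters"
  using assms aut_closed[OF assms(1)] unfolding prime_filters_def pull_def heyting_aut_def heyting_iso_def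
  by (simp add: zero_closed one_closed meet_closed join_closed)

text \<open>Only the values of \<open>f\<close> on \<open>Ls i\<close> enter
  \<open>pull f G \<inter> Ls i\<close>, which is the source of continuity. The assumptions are
  symmetric in \<open>f\<close> and \<open>f'\<close>, so one inclusion yields equality.\<close>

lemma act_stable:
  assumes f: "f \<in> heyting_aut L" "f' \<in> heyting_aut L"
    and U: "\<forall>F\<in>U. \<forall>G\<in>prime_filters. F \<inter> Ls i = G \<inter> Ls i \<longrightarrow> G \<in> U"
    and agree: "\<forall>x\<in>Ls i. f x = f' x"
  shows "act f U \<subseteq> act f' U"
proof
  fix G assume "G \<in> act f U"
  then have G: "G \<in> prime_filters" "pull f G \<in> U" by (auto simp: act_def)
  have "pull f G \<inter> Ls i = pull f' G \<inter> Ls i" using agree by (auto simp: pull_def)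
  then show "G \<in> act f' U"
    using G U pull_prime_filter[OF f(2) G(1)] by (simp add: act_def)
qed

text \<open>If membership in \<open>U\<close> is decided on \<open>Ls i\<close>, membership in
  \<open>act f U\<close> is decided on the image of \<open>Ls i\<close> under \<open>f\<close>. That
  image is finite and so lies in some later stage \<open>Ls j\<close>.\<close>

lemma act_clopen:
  assumes f: "f \<in> heyting_aut L" and U: "U \<in> clopens"
  shows "act f U \<in> clopens"
proof -
  obtain i where i: "\<forall>F\<in>U. \<forall>G\<in>prime_filters. F \<inter> Ls i = G \<inter> Ls i \<longrightarrow> G \<in> U"
    using U by (auto simp: clopens_def)
  have "f ` Ls i \<subseteq> carrier L" using aut_closed[OF f] stage_closed by auto
  then obtain j where j: "f ` Ls i \<subseteq> Ls j"
    using finite_subset_some_stage[of "f ` Ls i"] finite_stage by auto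
  have "G \<in> act f U" if F: "F \<in> act f U" and G: "G \<in> prime_filters" and eq: "F \<inter> Ls j = G \<inter> Ls j" for F G
  proof -
    have "pull f F \<inter> Ls i = pull f G \<inter> Ls i" using eq j by (auto simp: pull_def)
    moreover have "pull f F \<in> U" using F by (simp add: act_def)
    ultimately have "pull f G \<in> U" using i pull_prime_filter[OF f G] by blast
    then show ?thesis using G by (simp add: act_def)
  qed
  then show ?thesis unfolding clopens_def by (auto simp: act_def)
qed

lemma act_Int: "act f (U \<inter> V) = act f U \<inter> act f V"
  by (auto simp: act_def)

lemma act_Un: "act f (U \<union> V) = act f U \<union> act f V"
  by (auto simp: act_def)

lemma act_compl: "f \<in> heyting_aut L \<Longrightarrow> act f (prime_filters - U) = prime_filters - act f U"
  by (auto simp: act_def pull_prime_filter)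

lemma act_one: "f \<in> heyting_aut L \<Longrightarrow> act f prime_filters = prime_filters"
  by (auto simp: act_def pull_prime_filter)

lemma act_compose:
  assumes "f \<in> heyting_aut L" "g \<in> heyting_aut L"
  shows "act (compose (carrier L) f g) U = act f (act g U)"
proof -
  have "pull (compose (carrier L) f g) G = pull g (pull f G)" for G
    using aut_closed[OF assms(2)] by (auto simp: pull_def compose_def)
  then show ?thesis using pull_prime_filter[OF assms(1)] by (auto simp: act_def)
qed

lemma act_id:
  assumes "U \<in> clopens"
  shows "act (\<lambda>x\<in>carrier L. x) U = U"
proof -
  have "pull (\<lambda>x\<in>carrier L. x) G = G" if "G \<in> prime_filters" for G
    using that by (auto simp: pull_def prime_filters_def)
  then show ?thesis using assms by (auto simp: act_def clopens_def)
qed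

lemma act_filters_through:
  "x \<in> carrier L \<Longrightarrow> f \<in> heyting_aut L \<Longrightarrow> act f (filters_through x) = filters_through (f x)"
  by (auto simp: act_def filters_through_def pull_prime_filter) (auto simp: pull_def)

interpretation aut: subgroup "heyting_aut L" "BijGroup (carrier L)"
  by (rule subgroup_heyting_aut[OF heyting_algebra_axioms])

interpretation bij: group "BijGroup (carrier L)"
  by (rule group_BijGroup)

section \<open>The induced Boolean automorphism and its uniqueness\<close>

lemma extend_closed:
  assumes "f \<in> heyting_aut L"
  shows "extend f \<in> carrier B \<rightarrow> carrier B"
  using act_clopen[OF assms] by (auto simp: carrier_B extend_limit_point)

lemma extend_compose:
  assumes "f \<in> heyting_aut L" "g \<in> heyting_aut L"
  shows "extend (compose (carrier L) f g) = compose (carrier B) (extend f) (extend g)"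
proof (rule extensionalityI[of _ "carrier B"])
  fix X assume "X \<in> carrier B"
  then obtain U where "U \<in> clopens" "X = limit_point U" by (auto simp: carrier_B)
  then show "extend (compose (carrier L) f g) X = compose (carrier B) (extend f) (extend g) X"
    using act_clopen[OF assms(2)] assms
    by (simp add: compose_eq carrier_B extend_limit_point act_compose)
qed (auto simp: extend_def)

text \<open>Bijectivity of the extension comes from functoriality: the group inverse of
  \<open>f\<close> extends to a two-sided inverse.\<close>

lemma extend_inverse:
  assumes f: "f \<in> heyting_aut L"
  shows "\<exists>g\<in>heyting_aut L. \<forall>X\<in>carrier B. extend g (extend f X) = X \<and> extend f (extend g X) = X"
proof -
  let ?G = "BijGroup (carrier L)"
  define g where "g = inv\<^bsub>?G\<^esub> f"
  have g: "g \<in> heyting_aut L" using f by (simp add: g_def)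
  have fB: "f \<in> carrier ?G" "g \<in> carrier ?G" using f g aut.subset by blast+
  have "g \<otimes>\<^bsub>?G\<^esub> f = \<one>\<^bsub>?G\<^esub>" "f \<otimes>\<^bsub>?G\<^esub> g = \<one>\<^bsub>?G\<^esub>"
    using fB(1) unfolding g_def by (simp_all only: bij.l_inv bij.r_inv)
  then have inv: "compose (carrier L) g f = (\<lambda>x\<in>carrier L. x)" "compose (carrier L) f g = (\<lambda>x\<in>carrier L. x)"
    using fB by (simp_all add: BijGroup_def)
  have "extend g (extend f X) = X \<and> extend f (extend g X) = X" if "X \<in> carrier B" for X
  proof -
    obtain U where U: "U \<in> clopens" "X = limit_point U" using \<open>X \<in> carrier B\<close> by (auto simp: carrier_B)
    have "act g (act f U) = U" "act f (act g U) = U"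
      using act_compose[OF g f, of U] act_compose[OF f g, of U] inv act_id[OF U(1)] by simp_all
    then show ?thesis using U act_clopen f g by (simp add: extend_limit_point)
  qed
  then show ?thesis using g by blast
qed

lemma extend_aut:
  assumes f: "f \<in> heyting_aut L"
  shows "extend f \<in> boolean_aut B"
proof -
  obtain g where g: "g \<in> heyting_aut L"
      "\<forall>X\<in>carrier B. extend g (extend f X) = X \<and> extend f (extend g X) = X"
    using extend_inverse[OF f] by (elim bexE)
  have "bij_betw (extend f) (carrier B) (carrier B)"
    by (rule bij_betw_byWitness[of _ "extend g"])
      (use g(2) extend_closed[OF f] extend_closed[OF g(1)] in auto)
  moreover have "extend f (bcompl B X) = bcompl B (extend f X)" if "X \<in> carrier B" for X
    using that act_clopen[OF f] act_compl[OF f]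
    by (auto simp: carrier_B extend_limit_point B_compl clopens_compl)
  moreover have "extend f (X \<curlywedge>\<^bsub>B\<^esub> Y) = extend f X \<curlywedge>\<^bsub>B\<^esub> extend f Y"
    "extend f (X \<curlyvee>\<^bsub>B\<^esub> Y) = extend f X \<curlyvee>\<^bsub>B\<^esub> extend f Y"
    if "X \<in> carrier B" "Y \<in> carrier B" for X Y
    using that act_clopen[OF f]
    by (auto simp: carrier_B extend_limit_point B_meet B_join clopens_Int clopens_Un act_Int act_Un)
  moreover have "extend f (lzero B) = lzero B"
    by (simp add: B_zero extend_limit_point clopens_empty) (simp add: act_def)
  moreover have "extend f (lone B) = lone B"
    by (simp add: B_one extend_limit_point clopens_one act_one[OF f])
  moreover have "extend f \<in> extensional (carrier B)" by (simp add: extend_def)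
  ultimately show ?thesis
    by (auto simp: boolean_aut_def boolean_iso_def Bij_def)
qed

lemma extend_is_extension:
  assumes f: "f \<in> heyting_aut L"
  shows "is_boolean_extension L Ls f (extend f)"
  using extend_aut[OF f] aut_closed[OF f] f
  by (simp add: is_boolean_extension_def limit_embed_eq extend_limit_point filters_through_clopen
      act_filters_through)

text \<open>Two extensions agree on the image of \<open>L\<close>, agreement passes through Boolean
  operations, and the image generates. Outside the carrier both are fixed by extensionality.\<close>

lemma boolean_extension_unique:
  assumes "is_boolean_extension L Ls f g" "is_boolean_extension L Ls f h"
  shows "g = h"
proof -
  have iso: "g \<in> boolean_iso B B" "h \<in> boolean_iso B B"
    and ext: "g \<in> extensional (carrier B)" "h \<in> extensional (carrier B)"
    using assms by (auto simp: is_boolean_extension_def boolean_aut_def Bij_def)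
  have "g (limit_point U) = h (limit_point U)" if "U \<in> clopens" for U
    using that
  proof (induction U rule: clopens_induct)
    case (embed x)
    then show ?case using assms by (simp add: is_boolean_extension_def flip: limit_embed_eq)
  next
    case (compl U)
    have "k (limit_point (prime_filters - U)) = bcompl B (k (limit_point U))"
      if "k \<in> boolean_iso B B" for k
      using that compl by (simp add: boolean_iso_def carrier_B flip: B_compl)
    from this[OF iso(1)] this[OF iso(2)] show ?case using compl by simp
  next
    case (Int U V)
    have "k (limit_point (U \<inter> V)) = k (limit_point U) \<curlywedge>\<^bsub>B\<^esub> k (limit_point V)"
      if "k \<in> boolean_iso B B" for k
      using that Int by (simp add: boolean_iso_def carrier_B flip: B_meet)
    from this[OF iso(1)] this[OF iso(2)] show ?case using Int by simp
  next
    case (Un U V)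
    have "k (limit_point (U \<union> V)) = k (limit_point U) \<curlyvee>\<^bsub>B\<^esub> k (limit_point V)"
      if "k \<in> boolean_iso B B" for k
      using that Un by (simp add: boolean_iso_def carrier_B flip: B_join)
    from this[OF iso(1)] this[OF iso(2)] show ?case using Un by simp
  qed
  then show ?thesis
    using ext by (intro extensionalityI[of _ "carrier B"]) (auto simp: carrier_B)
qed

lemma ex1_boolean_extension: "f \<in> heyting_aut L \<Longrightarrow> \<exists>!g. is_boolean_extension L Ls f g"
  using extend_is_extension boolean_extension_unique by blast

lemma boolean_extension_eq: "f \<in> heyting_aut L \<Longrightarrow> boolean_extension L Ls f = extend f"
  unfolding boolean_extension_def using extend_is_extension boolean_extension_unique
  by (intro the_equality) blast+

section \<open>The homomorphism of automorphism groups\<close>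

lemma subgroup_boolean_aut_B: "subgroup (boolean_aut B) (BijGroup (carrier B))"
proof (rule subgroup_boolean_aut)
  show "lzero B \<in> carrier B" "lone B \<in> carrier B"
    by (simp_all add: B_zero B_one carrier_B clopens_empty clopens_one)
qed (auto simp: carrier_B B_compl B_meet B_join clopens_compl clopens_Int clopens_Un)

lemma group_hom_boolean_extension:
  "group_hom (heyting_aut_group L) (boolean_aut_group B) (boolean_extension L Ls)"
proof (intro group_hom.intro group_hom_axioms.intro)
  show "group (heyting_aut_group L)"
    unfolding heyting_aut_group_def by (rule subgroup.subgroup_is_group[OF aut.subgroup_axioms group_BijGroup])
  show "group (boolean_aut_group B)"
    unfolding boolean_aut_group_def by (rule subgroup.subgroup_is_group[OF subgroup_boolean_aut_B group_BijGroup])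
  have HBij: "f \<in> Bij (carrier L)" if "f \<in> heyting_aut L" for f
    using that by (simp add: heyting_aut_def)
  have BBij: "extend f \<in> Bij (carrier B)" if "f \<in> heyting_aut L" for f
    using extend_aut[OF that] by (simp add: boolean_aut_def)
  have "compose (carrier L) f g \<in> heyting_aut L" if "f \<in> heyting_aut L" "g \<in> heyting_aut L" for f g
    using aut.m_closed[OF that] HBij that by (simp add: BijGroup_def)
  then show "boolean_extension L Ls \<in> hom (heyting_aut_group L) (boolean_aut_group B)"
    by (auto simp: hom_def heyting_aut_group_def boolean_aut_group_def BijGroup_def HBij BBij
        boolean_extension_eq extend_aut extend_compose)
qed

text \<open>The extension determines the embedded image of \<open>f x\<close> for each
  \<open>x\<close>, and the embedding of \<open>L\<close> is injective.\<close>

lemma inj_boolean_extension: "inj_on (boolean_extension L Ls) (heyting_aut L)"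
proof
  fix f f' assume f: "f \<in> heyting_aut L" "f' \<in> heyting_aut L"
    and eq: "boolean_extension L Ls f = boolean_extension L Ls f'"
  have "f x = f' x" if x: "x \<in> carrier L" for x
  proof -
    have "limit_embed L Ls (f x) = limit_embed L Ls (f' x)"
      using extend_is_extension[OF f(1)] extend_is_extension[OF f(2)] eq f x
      by (simp add: is_boolean_extension_def boolean_extension_eq)
    then show ?thesis using inj_onD[OF inj_limit_embed] aut_closed f x by blast
  qed
  then show "f = f'"
    using f by (intro extensionalityI[of _ "carrier L"]) (auto simp: heyting_aut_def Bij_def)
qed

text \<open>Both directions rest on determination by finitely many values: an extension at
  \<open>X\<close> is determined by \<open>f\<close> on one finite stage, and \<open>f\<close> at
  \<open>x\<close> is determined by the extension at the embedded \<open>x\<close>.\<close>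

lemma embedding_boolean_extension:
  "embedding_map (heyting_aut_topology L) (boolean_aut_topology B) (boolean_extension L Ls)"
proof -
  let ?E = "boolean_extension L Ls" and ?A = "heyting_aut L"
  have E: "?E f \<in> boolean_aut B" if "f \<in> ?A" for f
    using that by (simp add: boolean_extension_eq extend_aut)
  have PiE: "?A \<subseteq> carrier L \<rightarrow>\<^sub>E carrier L" "boolean_aut B \<subseteq> carrier B \<rightarrow>\<^sub>E carrier B"
    by (auto simp: heyting_aut_def boolean_aut_def Bij_def PiE_def dest: bij_betwE)
  have "continuous_map (heyting_aut_topology L) (boolean_aut_topology B) ?E"
    unfolding heyting_aut_topology_def boolean_aut_topology_def
  proof (rule continuous_map_pointwise_topology[OF PiE(1) PiE(2)])
    fix X assume "X \<in> carrier B"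
    then obtain U where U: "U \<in> clopens" "X = limit_point U" by (auto simp: carrier_B)
    obtain i where i: "\<forall>F\<in>U. \<forall>G\<in>prime_filters. F \<inter> Ls i = G \<inter> Ls i \<longrightarrow> G \<in> U"
      using U(1) by (auto simp: clopens_def)
    have "?E f X = ?E f' X" if "f \<in> ?A" "f' \<in> ?A" "\<forall>x\<in>Ls i. f x = f' x" for f f'
    proof -
      have "act f U = act f' U"
        using act_stable[OF that(1,2) i] act_stable[OF that(2,1) i] that(3) by auto
      then show ?thesis using that U by (simp add: boolean_extension_eq extend_limit_point)
    qed
    then show "\<exists>K. finite K \<and> K \<subseteq> carrier L \<and>
        (\<forall>f\<in>?A. \<forall>f'\<in>?A. (\<forall>x\<in>K. f x = f' x) \<longrightarrow> ?E f X = ?E f' X)"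
      using finite_stage[of i] stage_closed[of _ i] by blast
  qed (use E in auto)
  \<comment> \<open>The image with its subspace topology is rewritten as a pointwise topology on a
    smaller set of maps, so that the same continuity criterion applies.\<close>
  moreover have "continuous_map (subtopology (boolean_aut_topology B) (?E ` ?A)) (heyting_aut_topology L)
      (inv_into ?A ?E)"
    unfolding heyting_aut_topology_def boolean_aut_topology_def pointwise_topology_def[of _ "boolean_aut B"]
      subtopology_subtopology pointwise_topology_def[of _ "boolean_aut B \<inter> ?E ` ?A", symmetric]
  proof (rule continuous_map_pointwise_topology)
    show "boolean_aut B \<inter> ?E ` ?A \<subseteq> carrier B \<rightarrow>\<^sub>E carrier B" using PiE(2) by blast
    show "?A \<subseteq> carrier L \<rightarrow>\<^sub>E carrier L" by (rule PiE(1))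
    show "inv_into ?A ?E g \<in> ?A" if "g \<in> boolean_aut B \<inter> ?E ` ?A" for g
      using that by (auto intro: inv_into_into)
    fix x assume x: "x \<in> carrier L"
    have "f x = f' x"
      if "f \<in> ?A" "f' \<in> ?A" "?E f (limit_embed L Ls x) = ?E f' (limit_embed L Ls x)" for f f'
    proof -
      have "limit_embed L Ls (f x) = limit_embed L Ls (f' x)"
        using extend_is_extension[OF that(1)] extend_is_extension[OF that(2)] that x
        by (simp add: is_boolean_extension_def boolean_extension_eq)
      then show ?thesis using inj_onD[OF inj_limit_embed] aut_closed that x by blast
    qed
    then have "\<forall>g\<in>boolean_aut B \<inter> ?E ` ?A. \<forall>g'\<in>boolean_aut B \<inter> ?E ` ?A.
        (\<forall>X\<in>{limit_embed L Ls x}. g X = g' X) \<longrightarrow> inv_into ?A ?E g x = inv_into ?A ?E g' x"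
      by (auto simp: inv_into_f_f[OF inj_boolean_extension])
    moreover have "finite {limit_embed L Ls x}" "{limit_embed L Ls x} \<subseteq> carrier B"
      using limit_embed_closed[OF x] by simp_all
    ultimately show "\<exists>K. finite K \<and> K \<subseteq> carrier B \<and>
        (\<forall>g\<in>boolean_aut B \<inter> ?E ` ?A. \<forall>g'\<in>boolean_aut B \<inter> ?E ` ?A.
          (\<forall>X\<in>K. g X = g' X) \<longrightarrow> inv_into ?A ?E g x = inv_into ?A ?E g' x)"
      by (intro exI conjI)
  qed
  moreover have "topspace (heyting_aut_topology L) = ?A"
    using PiE(1) by (simp add: heyting_aut_topology_def topspace_pointwise_topology)
  ultimately have "homeomorphic_maps (heyting_aut_topology L)
      (subtopology (boolean_aut_topology B) (?E ` ?A)) ?E (inv_into ?A ?E)"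
    by (auto simp: homeomorphic_maps_def continuous_map_in_subtopology
        inv_into_f_f[OF inj_boolean_extension])
  then show ?thesis
    unfolding embedding_map_def \<open>topspace (heyting_aut_topology L) = ?A\<close>
    by (rule homeomorphic_maps_imp_map)
qed

end

theorem theorem2p4:
  fixes L :: "'a heyting" and Ls :: "nat \<Rightarrow> 'a set"
  assumes "heyting_fraisse_limit L"
    and "finite_subalgebra_chain L Ls"
  shows "(\<forall>f \<in> heyting_aut L. \<exists>!g. is_boolean_extension L Ls f g) \<and>
    group_hom (heyting_aut_group L) (boolean_aut_group (limit_boolean L Ls))
      (boolean_extension L Ls) \<and>
    inj_on (boolean_extension L Ls) (heyting_aut L) \<and>
    embedding_map (heyting_aut_topology L) (boolean_aut_topology (limit_boolean L Ls))
      (boolean_extension L Ls)"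
proof -
  interpret heyting_chain L Ls
    using assms by (intro heyting_chain.intro heyting_chain_axioms.intro)
      (simp_all add: heyting_fraisse_limit_def)
  show ?thesis
    using ex1_boolean_extension group_hom_boolean_extension inj_boolean_extension
      embedding_boolean_extension by blast
qed

end
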